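(* Let $\mathbb{K}$ be a field supporting FFT, let $d\ge 1$, let $c_0,\dots,c_{d-1}\in \mathbb{K}$ and $u_0,\dots,u_{d-1}\in \mathbb{K}$, and let $(u_n)_{n\ge 0}$ be the linearly recurrent sequence of order $d$ with these initial terms defined by $$u_{n+d}=c_{d-1}u_{n+d-1}+\dots+c_0u_n,\qquad n\ge 0.$$ Given $c_0,\dots,c_{d-1}$, $u_0,\dots,u_{d-1}$ and a positive integer $N$, one can compute the term $u_N$ using $$\sim \frac{2}{3}\,\mathsf{M}(d)\,\log(N)$$ arithmetic operations in $\mathbb{K}$.
   Context: Complexity is measured by counting arithmetic operations in $\mathbb{K}$, and $\log$ is the logarithm in base $2$. "Supporting FFT" means the following: with $k$ the minimum integer such that $2^k\ge 2d+1$, the field $\mathbb{K}$ contains a (known) primitive $2^k$-th root of unity. For $n$ a power of two dividing $2^k$ and $\omega_n$ a primitive $n$-th root of unity, the discrete Fourier transform (DFT) of length $n$ of a polynomial $A\in\mathbb{K}[x]$ of degree less than $n$ is the vector $(A(\omega_n^{-y}))_{0\le y\le n-1}$; $\mathsf{E}(n)$ denotes the arithmetic complexity of computing a DFT of length $n$ by the Fast Fourier Transform (decimation-in-time Cooley--Tukey algorithm), $\mathsf{E}(n)=\frac32 n\log n$ for $n$ a power of two. In this FFT setting, polynomial multiplication in $\mathbb{K}[x]$ in degree $d$ is assumed to be performed by two DFTs and one inverse DFT, and $\mathsf{M}(d)$ denotes its arithmetic cost: $\mathsf{M}(d)=3\,\mathsf{E}(2d)+O(d)$, where the length $2d$ is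 understood to be rounded to the power of two $2^k$ above (when $d$ is of the form $2^\ell-1$ this gives $\mathsf{M}(d)=9\,d\log d+O(d)$). The symbol $\sim$ refers to asymptotic equivalence: the number of operations is $(1+o(1))\cdot\frac23\,\mathsf{M}(d)\log N$ as $d$ and $N$ tend to infinity. *)

theory Defs
  imports
    Complex_Main
    "HOL-Library.FuncSet"
    "HOL-Library.Landau_Symbols"
    "HOL-Algebra.Multiplicative_Group"
begin

datatype arith_op = Add | Sub | Mul | Div

text \<open>
  The instruction \<open>(f, i, j)\<close> applies \<open>f\<close> to the contents of the memory cells \<open>i\<close> and \<open>j\<close> and
  appends the result to the memory. A program is a list of instructions together with the address of
  the cell that holds its output. No field elements occur in a program, so the same program can be
  run over any field; every constant has to be computed from the initial memory.
\<close>

type_synonym instr = "arith_op \<times> nat \<times> nat"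
type_synonym slp = "instr list \<times> nat"

fun apply_op :: "('a, 'b) ring_scheme \<Rightarrow> arith_op \<Rightarrow> 'a \<Rightarrow> 'a \<Rightarrow> 'a option" where
  "apply_op K Add x y = Some (x \<oplus>\<^bsub>K\<^esub> y)"
| "apply_op K Sub x y = Some (x \<ominus>\<^bsub>K\<^esub> y)"
| "apply_op K Mul x y = Some (x \<otimes>\<^bsub>K\<^esub> y)"
| "apply_op K Div x y = (if y = \<zero>\<^bsub>K\<^esub> then None else Some (x \<otimes>\<^bsub>K\<^esub> inv\<^bsub>K\<^esub> y))"

fun exec :: "('a, 'b) ring_scheme \<Rightarrow> instr list \<Rightarrow> 'a list \<Rightarrow> 'a list option" where
  "exec K [] mem = Some mem"
| "exec K ((f, i, j) # is) mem =
     (if i < length mem \<and> j < length mem then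
        (case apply_op K f (mem ! i) (mem ! j) of
           None \<Rightarrow> None
         | Some x \<Rightarrow> exec K is (mem @ [x]))
      else None)"

definition slp_result :: "('a, 'b) ring_scheme \<Rightarrow> slp \<Rightarrow> 'a list \<Rightarrow> 'a option" where
  "slp_result K p inputs =
     (case exec K (fst p) inputs of
        None \<Rightarrow> None
      | Some mem \<Rightarrow> (if snd p < length mem then Some (mem ! snd p) else None))"

definition slp_cost :: "slp \<Rightarrow> nat" where
  "slp_cost p = length (fst p)"

definition fft_exponent :: "nat \<Rightarrow> nat" where
  "fft_exponent d = (LEAST k. 2 * d + 1 \<le> 2 ^ k)"

definition primitive_root_of_unity :: "('a, 'b) ring_scheme \<Rightarrow> nat \<Rightarrow> 'a \<Rightarrow> bool" where
  "primitive_root_of_unity K n \<omega> \<longleftrightarrow>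
     0 < n \<and> \<omega> \<in> carrier (mult_of K) \<and> group.ord (mult_of K) \<omega> = n"

definition supports_FFT :: "('a, 'b) ring_scheme \<Rightarrow> nat \<Rightarrow> 'a \<Rightarrow> bool" where
  "supports_FFT K d \<omega> \<longleftrightarrow> field K \<and> primitive_root_of_unity K (2 ^ fft_exponent d) \<omega>"

text \<open>
  For \<open>n\<close> a power of two, a decimation-in-time Cooley--Tukey FFT of length \<open>n\<close> has \<open>log 2 n\<close> layers
  of \<open>n / 2\<close> butterflies, each made of one multiplication, one addition and one subtraction.
\<close>

definition FFT_cost :: "nat \<Rightarrow> real" where
  "FFT_cost n = 3 / 2 * real n * log 2 (real n)"

text \<open>
  A cost function for multiplication in degree \<open>d\<close> by two DFTs and one inverse DFT is only specified
  up to the linear cost of the remaining work. The transforms have length \<open>2 d\<close>, rounded up to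
  the power of two \<open>2 ^ fft_exponent d\<close>.
\<close>

definition FFT_mult_cost :: "(nat \<Rightarrow> real) \<Rightarrow> bool" where
  "FFT_mult_cost M \<longleftrightarrow> (\<lambda>d. M d - 3 * FFT_cost (2 ^ fft_exponent d)) \<in> O(\<lambda>d. real d)"

definition lin_rec_seq :: "('a, 'b) ring_scheme \<Rightarrow> nat \<Rightarrow> (nat \<Rightarrow> 'a) \<Rightarrow> (nat \<Rightarrow> 'a) \<Rightarrow> bool" where
  "lin_rec_seq K d c u \<longleftrightarrow>
     c \<in> {..<d} \<rightarrow> carrier K \<and> u \<in> {..<d} \<rightarrow> carrier K \<and>
     (\<forall>n. u (n + d) = (\<Oplus>\<^bsub>K\<^esub>i\<in>{..<d}. c i \<otimes>\<^bsub>K\<^esub> u (n + i)))"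

definition nth_term_inputs :: "('a, 'b) ring_scheme \<Rightarrow> 'a \<Rightarrow> nat \<Rightarrow> (nat \<Rightarrow> 'a) \<Rightarrow> (nat \<Rightarrow> 'a) \<Rightarrow> 'a list" where
  "nth_term_inputs K \<omega> d c u = [\<one>\<^bsub>K\<^esub>, \<omega>] @ map c [0..<d] @ map u [0..<d]"

end

theory Submission
  imports Defs
begin

text \<open>
  The algorithm is that of Bostan and Mori. The generating function of the sequence is \<open>P(x) / Q(x)\<close>
  with \<open>Q(x) = 1 - c (d - 1) x - \<dots> - c 0 x^d\<close>. Multiplying numerator and denominator by \<open>Q(-x)\<close> makes
  the denominator an even function, so the subsequence of index parity \<open>N mod 2\<close> again has a generating
  function of this shape, and its term of index \<open>N div 2\<close> is wanted. About \<open>log 2 N\<close> such steps lead to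
  index 0. Both polynomials are stored by their values at the \<open>n\<close>-th roots of unity, \<open>n \<ge> 2 d + 1\<close>. Then
  \<open>Q(-x)\<close> is a cyclic shift, the products are pointwise, and one step yields the values of the new
  polynomials at the \<open>n / 2\<close>-th roots of unity only. The missing values cost one inverse and one direct
  transform of length \<open>n / 2\<close> for each polynomial, i.e. the equivalent of two of the three transforms of
  length \<open>n\<close> in one multiplication.
\<close>

section \<open>Polynomials and power series as coefficient sequences\<close>

text \<open>Programs contain no field elements and have to serve every field that supports the
  transform. Each address must therefore be fixed before the field is known, and no test on field
  elements is available. None is needed: every choice made during the construction depends on
  \<open>d\<close> and on the binary digits of \<open>N\<close> only, and these are known when the
  program is built. The limit is taken in \<open>d\<close> and \<open>N\<close> jointly, so an
  estimate for fixed \<open>d\<close> or fixed \<open>N\<close> would not suffice. Explicit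
  operation counts are carried through all phases, and their quotient by the main term is bounded by
  an expression in \<open>1 / log N\<close> and the reciprocal of the logarithm of the transform
  length. Division by two occurs in the splitting of a polynomial by parity and in the inverse
  transforms. It is legitimate because a primitive root of unity of even order forces
  \<open>-1\<close> to differ from \<open>1\<close>.\<close>

definition evalp :: "('a, 'b) ring_scheme \<Rightarrow> (nat \<Rightarrow> 'a) \<Rightarrow> nat \<Rightarrow> 'a \<Rightarrow> 'a" where
  "evalp K f n x = (\<Oplus>\<^bsub>K\<^esub>i\<in>{..<n}. f i \<otimes>\<^bsub>K\<^esub> x [^]\<^bsub>K\<^esub> i)"

text \<open>The supports are unbounded, so a factor may be a power series: in the invariant
  \<open>conv R q w = p\<close> the factor \<open>w\<close> is an infinite sequence.\<close>

definition conv :: "('a, 'b) ring_scheme \<Rightarrow> (nat \<Rightarrow> 'a) \<Rightarrow> (nat \<Rightarrow> 'a) \<Rightarrow> nat \<Rightarrow> 'a" where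
  "conv K f g n = (\<Oplus>\<^bsub>K\<^esub>i\<in>{..n}. f i \<otimes>\<^bsub>K\<^esub> g (n - i))"

text \<open>The coefficients of \<open>f(-x)\<close>.\<close>

definition alt :: "('a, 'b) ring_scheme \<Rightarrow> (nat \<Rightarrow> 'a) \<Rightarrow> nat \<Rightarrow> 'a" where
  "alt K f i = (if even i then f i else \<ominus>\<^bsub>K\<^esub> f i)"

text \<open>The reversed characteristic polynomial \<open>1 - c (d - 1) x - \<dots> - c 0 x^d\<close>.\<close>

definition rec_denom :: "('a, 'b) ring_scheme \<Rightarrow> nat \<Rightarrow> (nat \<Rightarrow> 'a) \<Rightarrow> nat \<Rightarrow> 'a" where
  "rec_denom K d c m =
     (if m = 0 then \<one>\<^bsub>K\<^esub> else if m \<le> d then \<ominus>\<^bsub>K\<^esub> c (d - m) else \<zero>\<^bsub>K\<^esub>)"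

context cring
begin

lemma finsum_lessThan_Suc:
  "f \<in> UNIV \<rightarrow> carrier R \<Longrightarrow> (\<Oplus>i\<in>{..<Suc n}. f i) = (\<Oplus>i\<in>{..<n}. f i) \<oplus> f n"
  by (subst lessThan_Suc) (simp add: Pi_def a_comm)

lemma evalp_closed [simp]:
  "f \<in> UNIV \<rightarrow> carrier R \<Longrightarrow> x \<in> carrier R \<Longrightarrow> evalp R f n x \<in> carrier R"
  unfolding evalp_def by (rule finsum_closed) auto

lemma evalp_0 [simp]: "evalp R f 0 x = \<zero>"
  by (simp add: evalp_def)

lemma evalp_Suc:
  "f \<in> UNIV \<rightarrow> carrier R \<Longrightarrow> x \<in> carrier R \<Longrightarrow>
   evalp R f (Suc n) x = evalp R f n x \<oplus> f n \<otimes> x [^] n"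
  unfolding evalp_def by (rule finsum_lessThan_Suc) auto

lemma evalp_extend:
  assumes "f \<in> UNIV \<rightarrow> carrier R" "x \<in> carrier R" "m \<le> n" "\<And>i. m \<le> i \<Longrightarrow> f i = \<zero>"
  shows "evalp R f n x = evalp R f m x"
  using assms(3)
proof (induction n rule: dec_induct)
  case (step n)
  then show ?case using assms by (simp add: evalp_Suc)
qed simp

lemma conv_closed: "f \<in> UNIV \<rightarrow> carrier R \<Longrightarrow> g \<in> UNIV \<rightarrow> carrier R \<Longrightarrow> conv R f g \<in> UNIV \<rightarrow> carrier R"
  unfolding conv_def by (auto intro!: finsum_closed)

lemma alt_closed: "f \<in> UNIV \<rightarrow> carrier R \<Longrightarrow> alt R f \<in> UNIV \<rightarrow> carrier R"
  by (auto simp: alt_def Pi_def)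

lemma conv_assoc:
  assumes R: "f \<in> UNIV \<rightarrow> carrier R" "g \<in> UNIV \<rightarrow> carrier R" "h \<in> UNIV \<rightarrow> carrier R"
  shows "conv R (conv R f g) h = conv R f (conv R g h)"
proof
  fix n
  \<comment> \<open>The bound \<open>k\<close> of the outer sum is kept apart from the degree
    \<open>n\<close>, so that the induction leaves the arguments of \<open>h\<close>
    unchanged.\<close>
  have "k \<le> n \<Longrightarrow>
      (\<Oplus>j\<in>{..k}. (\<Oplus>i\<in>{..j}. f i \<otimes> g (j - i)) \<otimes> h (n - j)) =
      (\<Oplus>j\<in>{..k}. f j \<otimes> (\<Oplus>i\<in>{..k - j}. g i \<otimes> h (n - j - i)))" (is "_ \<Longrightarrow> ?eq k") for k
  proof (induct k)
    case 0 then show ?case using R by (simp add: Pi_def m_assoc)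
  next
    case (Suc k)
    then have "?eq k" by simp
    with R Suc.prems show ?case
      by (simp cong: finsum_cong add: Suc_diff_le Pi_def l_distr r_distr m_assoc)
         (simp cong: finsum_cong add: Pi_def a_ac finsum_ldistr m_assoc)
  qed
  from this[of n] show "conv R (conv R f g) h n = conv R f (conv R g h) n"
    by (simp add: conv_def)
qed

lemma conv_comm:
  assumes R: "f \<in> UNIV \<rightarrow> carrier R" "g \<in> UNIV \<rightarrow> carrier R"
  shows "conv R f g = conv R g f"
proof
  fix n
  have "k \<le> n \<Longrightarrow> (\<Oplus>i\<in>{..k}. f i \<otimes> g (n - i)) = (\<Oplus>i\<in>{..k}. f (k - i) \<otimes> g (i + n - k))" for k
  proof (induct k)
    case 0 then show ?case using R by (simp add: Pi_def)
  next
    case (Suc k) then show ?case using R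
      by (subst (2) finsum_Suc2) (simp add: Pi_def a_comm)+
  qed
  from this[of n] show "conv R f g n = conv R g f n"
    unfolding conv_def using R by (simp add: Pi_def m_comm)
qed

lemma conv_eq_zero:
  assumes R: "f \<in> UNIV \<rightarrow> carrier R" "g \<in> UNIV \<rightarrow> carrier R"
    and "\<And>i. a < i \<Longrightarrow> f i = \<zero>" "\<And>i. b < i \<Longrightarrow> g i = \<zero>" "a + b < n"
  shows "conv R f g n = \<zero>"
proof -
  have "f i \<otimes> g (n - i) = \<zero>" if "i \<le> n" for i
  proof (cases "a < i")
    case False
    then have "b < n - i" using assms(5) by linarith
    then show ?thesis using assms by (auto simp: Pi_def)
  qed (use assms in \<open>auto simp: Pi_def\<close>)
  then have "conv R f g n = (\<Oplus>i\<in>{..n}. \<zero>)"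
    unfolding conv_def by (intro finsum_cong') auto
  then show ?thesis by simp
qed

text \<open>The product has degree at most \<open>a + b\<close>, so evaluation with \<open>n\<close>
  coefficients truncates none of the three sequences. With \<open>a = b = d\<close> this is where
  transforms of length at least \<open>2 * d + 1\<close> are called for.\<close>

lemma evalp_conv:
  assumes R: "f \<in> UNIV \<rightarrow> carrier R" "g \<in> UNIV \<rightarrow> carrier R" "x \<in> carrier R"
    and s: "\<And>i. a < i \<Longrightarrow> f i = \<zero>" "\<And>i. b < i \<Longrightarrow> g i = \<zero>" and n: "a + b < n"
  shows "evalp R (conv R f g) n x = evalp R f n x \<otimes> evalp R g n x"
proof -
  have "evalp R (conv R f g) n x = evalp R (conv R f g) (Suc (a + b)) x"
    using n conv_eq_zero[OF R(1,2) s] conv_closed[OF R(1,2)] R(3) by (intro evalp_extend) auto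
  also have "\<dots> = (\<Oplus>k\<in>{..a + b}. \<Oplus>i\<in>{..k}. f i \<otimes> x [^] i \<otimes> (g (k - i) \<otimes> x [^] (k - i)))"
    unfolding evalp_def lessThan_Suc_atMost
  proof (intro finsum_cong')
    fix k
    have "f i \<otimes> g (k - i) \<otimes> x [^] k = f i \<otimes> x [^] i \<otimes> (g (k - i) \<otimes> x [^] (k - i))" if "i \<le> k" for i
    proof -
      have "x [^] k = x [^] i \<otimes> x [^] (k - i)" using that R by (simp add: nat_pow_mult)
      then show ?thesis using R by (simp add: m_ac Pi_def)
    qed
    then show "conv R f g k \<otimes> x [^] k = (\<Oplus>i\<in>{..k}. f i \<otimes> x [^] i \<otimes> (g (k - i) \<otimes> x [^] (k - i)))"
      using R unfolding conv_def by (subst finsum_ldistr) (auto intro!: finsum_cong' simp: Pi_def)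
  qed (use R in \<open>auto intro!: finsum_closed simp: Pi_def\<close>)
  also have "\<dots> = (\<Oplus>i\<in>{..a}. f i \<otimes> x [^] i) \<otimes> (\<Oplus>i\<in>{..b}. g i \<otimes> x [^] i)"
    by (rule cauchy_product) (use R s in \<open>auto simp: bound_def Pi_def\<close>)
  also have "\<dots> = evalp R f (Suc a) x \<otimes> evalp R g (Suc b) x"
    by (simp add: evalp_def lessThan_Suc_atMost)
  also have "evalp R f (Suc a) x = evalp R f n x"
    using n R s by (intro evalp_extend[symmetric]) auto
  also have "evalp R g (Suc b) x = evalp R g n x"
    using n R s by (intro evalp_extend[symmetric]) auto
  finally show ?thesis .
qed

lemma pow_uminus: "x \<in> carrier R \<Longrightarrow> (\<ominus> x) [^] i = (if even i then x [^] i else \<ominus> (x [^] (i::nat)))"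
  by (induction i) (auto simp: l_minus r_minus)

lemma evalp_alt:
  assumes "f \<in> UNIV \<rightarrow> carrier R" "x \<in> carrier R"
  shows "evalp R (alt R f) n x = evalp R f n (\<ominus> x)"
  unfolding evalp_def using assms
  by (intro finsum_cong') (auto simp: alt_def pow_uminus Pi_def l_minus r_minus)

lemma alt_alt: "f \<in> UNIV \<rightarrow> carrier R \<Longrightarrow> alt R (alt R f) = f"
  by (auto simp: alt_def Pi_def)

lemma conv_alt:
  assumes R: "f \<in> UNIV \<rightarrow> carrier R" "g \<in> UNIV \<rightarrow> carrier R"
  shows "conv R (alt R f) (alt R g) = alt R (conv R f g)"
proof
  fix n
  show "conv R (alt R f) (alt R g) n = alt R (conv R f g) n"
  proof (cases "even n")
    case True
    have "alt R f i \<otimes> alt R g (n - i) = f i \<otimes> g (n - i)" if "i \<le> n" for i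
      using that True R by (auto simp: alt_def Pi_def l_minus r_minus)
    then show ?thesis
      using True R by (auto simp: alt_def[of _ _ n] conv_def Pi_def intro!: finsum_cong')
  next
    case False
    have "alt R f i \<otimes> alt R g (n - i) = \<ominus> \<one> \<otimes> (f i \<otimes> g (n - i))" if "i \<le> n" for i
      using that False R by (auto simp: alt_def Pi_def l_minus r_minus)
    then have "conv R (alt R f) (alt R g) n = (\<Oplus>i\<in>{..n}. \<ominus> \<one> \<otimes> (f i \<otimes> g (n - i)))"
      unfolding conv_def using R by (intro finsum_cong') (auto simp: Pi_def)
    also have "\<dots> = \<ominus> \<one> \<otimes> conv R f g n"
      unfolding conv_def using R by (intro finsum_rdistr[symmetric]) auto
    also have "\<dots> = \<ominus> conv R f g n"
      using conv_closed[OF R] by (simp add: l_minus Pi_def)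
    finally show ?thesis using False by (simp add: alt_def)
  qed
qed

text \<open>Decimation in time. It is used twice: as the recursion of the FFT, and to separate the
  two parity classes of coefficients in a halving step.\<close>

lemma evalp_even_odd:
  assumes R: "f \<in> UNIV \<rightarrow> carrier R" "x \<in> carrier R"
  shows "evalp R f (2 * m) x =
    evalp R (\<lambda>i. f (2 * i)) m (x \<otimes> x) \<oplus> x \<otimes> evalp R (\<lambda>i. f (2 * i + 1)) m (x \<otimes> x)"
proof (induction m)
  case (Suc m)
  have sq: "(x \<otimes> x) [^] m = x [^] (2 * m)"
    using R by (simp add: pow_mult_distrib m_comm mult_2 nat_pow_mult)
  let ?A = "evalp R (\<lambda>i. f (2 * i)) m (x \<otimes> x)" and ?B = "evalp R (\<lambda>i. f (2 * i + 1)) m (x \<otimes> x)"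
  have cl: "?A \<in> carrier R" "?B \<in> carrier R" "f (2 * m) \<in> carrier R" "f (2 * m + 1) \<in> carrier R" "x [^] (2 * m) \<in> carrier R"
    using R by (auto intro!: evalp_closed simp: Pi_def)
  have "evalp R f (2 * Suc m) x = ?A \<oplus> x \<otimes> ?B \<oplus> f (2 * m) \<otimes> x [^] (2 * m) \<oplus> f (2 * m + 1) \<otimes> (x [^] (2 * m) \<otimes> x)"
    using R Suc.IH by (simp add: evalp_Suc)
  also have "\<dots> = (?A \<oplus> f (2 * m) \<otimes> x [^] (2 * m)) \<oplus> x \<otimes> (?B \<oplus> f (2 * m + 1) \<otimes> x [^] (2 * m))"
    using cl R(2) by (simp add: r_distr a_ac m_ac)
  also have "\<dots> = evalp R (\<lambda>i. f (2 * i)) (Suc m) (x \<otimes> x) \<oplus> x \<otimes> evalp R (\<lambda>i. f (2 * i + 1)) (Suc m) (x \<otimes> x)"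
    using R by (simp add: evalp_Suc Pi_def sq)
  finally show ?case .
qed (use R in simp)

lemma finsum_odd_zero:
  assumes "g \<in> UNIV \<rightarrow> carrier R" "\<And>i. odd i \<Longrightarrow> g i = \<zero>" "b < (2::nat)"
  shows "(\<Oplus>i\<in>{..2 * m + b}. g i) = (\<Oplus>i\<in>{..m}. g (2 * i))"
proof -
  from \<open>b < 2\<close> have "b = 0 \<or> b = 1" by auto
  then show ?thesis
  proof
    assume b: "b = 0"
    have "(\<Oplus>i\<in>{..2 * m}. g i) = (\<Oplus>i\<in>{..m}. g (2 * i))"
      by (induction m) (use assms in \<open>auto simp: Pi_def\<close>)
    then show ?thesis using b by simp
  next
    assume b: "b = 1"
    have "(\<Oplus>i\<in>{..Suc (2 * m)}. g i) = (\<Oplus>i\<in>{..m}. g (2 * i))"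
      by (induction m) (use assms in \<open>auto simp: Pi_def\<close>)
    then show ?thesis using b by simp
  qed
qed

text \<open>An even factor preserves the parity of indices, so multiplication by it commutes with
  taking the terms of index parity \<open>b\<close>. This lets the identity between denominator,
  sequence and numerator survive the passage to every second term.\<close>

lemma conv_decimate:
  assumes R: "f \<in> UNIV \<rightarrow> carrier R" "g \<in> UNIV \<rightarrow> carrier R"
    and "\<And>i. odd i \<Longrightarrow> f i = \<zero>" "b < (2::nat)"
  shows "conv R f g (2 * m + b) = conv R (\<lambda>i. f (2 * i)) (\<lambda>i. g (2 * i + b)) m"
proof -
  have "conv R f g (2 * m + b) = (\<Oplus>i\<in>{..m}. f (2 * i) \<otimes> g (2 * m + b - 2 * i))"
    unfolding conv_def using assms by (intro finsum_odd_zero) (auto simp: Pi_def)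
  also have "\<dots> = conv R (\<lambda>i. f (2 * i)) (\<lambda>i. g (2 * i + b)) m"
    unfolding conv_def
  proof (intro finsum_cong')
    fix i assume "i \<in> {..m}"
    then have "2 * m + b - 2 * i = 2 * (m - i) + b" by auto
    then show "f (2 * i) \<otimes> g (2 * m + b - 2 * i) = f (2 * i) \<otimes> g (2 * (m - i) + b)" by simp
  qed (use R in \<open>auto simp: Pi_def\<close>)
  finally show ?thesis .
qed

lemma geometric_finsum:
  assumes "x \<in> carrier R"
  shows "(x \<ominus> \<one>) \<otimes> (\<Oplus>y\<in>{..<n::nat}. x [^] y) = x [^] n \<ominus> \<one>"
proof (induction n)
  case (Suc n)
  have cl: "(\<Oplus>y\<in>{..<n}. x [^] y) \<in> carrier R" "x [^] n \<in> carrier R" using assms by auto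
  have "(x \<ominus> \<one>) \<otimes> (\<Oplus>y\<in>{..<Suc n}. x [^] y) = (x \<ominus> \<one>) \<otimes> (\<Oplus>y\<in>{..<n}. x [^] y) \<oplus> (x \<ominus> \<one>) \<otimes> x [^] n"
    using assms cl by (subst finsum_lessThan_Suc) (auto simp: r_distr)
  also have "\<dots> = (x [^] n \<ominus> \<one>) \<oplus> (x \<ominus> \<one>) \<otimes> x [^] n" using Suc by simp
  also have "\<dots> = x [^] Suc n \<ominus> \<one>" unfolding nat_pow_Suc using cl assms by algebra
  finally show ?case .
qed (use assms in \<open>simp add: r_neg minus_eq\<close>)

lemma finsum_swap:
  assumes "\<And>i j. f i j \<in> carrier R"
  shows "(\<Oplus>i\<in>{..<n::nat}. \<Oplus>j\<in>{..<m::nat}. f i j) = (\<Oplus>j\<in>{..<m}. \<Oplus>i\<in>{..<n}. f i j)"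
proof (induction n)
  case (Suc n)
  have "(\<Oplus>i\<in>{..<Suc n}. \<Oplus>j\<in>{..<m}. f i j) = (\<Oplus>j\<in>{..<m}. \<Oplus>i\<in>{..<n}. f i j) \<oplus> (\<Oplus>j\<in>{..<m}. f n j)"
    using assms Suc by (subst finsum_lessThan_Suc) auto
  also have "\<dots> = (\<Oplus>j\<in>{..<m}. (\<Oplus>i\<in>{..<n}. f i j) \<oplus> f n j)"
    using assms by (subst finsum_addf) auto
  also have "\<dots> = (\<Oplus>j\<in>{..<m}. \<Oplus>i\<in>{..<Suc n}. f i j)"
    using assms by (intro finsum_cong') (auto simp: finsum_lessThan_Suc)
  finally show ?case .
qed simp

text \<open>The scalar left behind by a transform followed by the transform with the inverse root.
  It is written as a power of \<open>\<one> \<oplus> \<one>\<close> so that a power of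
  \<open>half\<close> cancels it.\<close>

lemma finsum_ones_pow2: "(\<Oplus>y\<in>{..<(2::nat) ^ m}. \<one>) = (\<one> \<oplus> \<one>) [^] m"
proof (induction m)
  case (Suc m)
  have "(\<Oplus>y\<in>{..<(2::nat) ^ Suc m}. \<one>) = (\<Oplus>y\<in>{..<(2::nat) ^ m} \<union> {2 ^ m..<2 ^ Suc m}. \<one>)"
    by (rule arg_cong[of _ _ "finsum R (\<lambda>y. \<one>)"]) auto
  also have "\<dots> = (\<Oplus>y\<in>{..<(2::nat) ^ m}. \<one>) \<oplus> (\<Oplus>y\<in>{(2::nat) ^ m..<2 ^ Suc m}. \<one>)"
    by (intro finsum_Un_disjoint) auto
  also have "(\<Oplus>y\<in>{(2::nat) ^ m..<2 ^ Suc m}. \<one>) = (\<Oplus>y\<in>{..<(2::nat) ^ m}. \<one>)"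
    by (simp add: add.finprod_const)
  also have "(\<Oplus>y\<in>{..<(2::nat) ^ m}. \<one>) \<oplus> (\<Oplus>y\<in>{..<(2::nat) ^ m}. \<one>) = (\<one> \<oplus> \<one>) [^] m \<otimes> (\<one> \<oplus> \<one>)"
    unfolding Suc by (simp add: r_distr)
  finally show ?case by simp
qed (simp add: lessThan_Suc)

lemma rec_denom_closed:
  "c \<in> {..<d} \<rightarrow> carrier R \<Longrightarrow> rec_denom R d c \<in> UNIV \<rightarrow> carrier R"
  by (auto simp: rec_denom_def Pi_def)

lemma lin_rec_seq_closed:
  assumes "1 \<le> d" and rec: "lin_rec_seq R d c u"
  shows "u \<in> UNIV \<rightarrow> carrier R"
proof -
  have "u n \<in> carrier R" for n
  proof (induction n rule: less_induct)
    case (less n)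
    show ?case
    proof (cases "n < d")
      case True
      then show ?thesis using rec by (auto simp: lin_rec_seq_def)
    next
      case False
      then have "u n = u ((n - d) + d)" by simp
      also have "\<dots> = (\<Oplus>i\<in>{..<d}. c i \<otimes> u (n - d + i))"
        using rec unfolding lin_rec_seq_def by blast
      also have "\<dots> \<in> carrier R"
        using rec less False by (intro finsum_closed) (auto simp: lin_rec_seq_def)
      finally show ?thesis .
    qed
  qed
  then show ?thesis by auto
qed

text \<open>Reversal of the summation index turns the coefficient into \<open>u (n + d)\<close>
  minus the right-hand side of the recurrence. Hence the generating function is a fraction whose
  numerator has degree below \<open>d\<close>.\<close>

lemma conv_rec_denom:
  assumes d: "1 \<le> d" and rec: "lin_rec_seq R d c u"
  shows "conv R (rec_denom R d c) u (n + d) = \<zero>"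
proof -
  let ?q = "rec_denom R d c"
  have u: "u m \<in> carrier R" for m using lin_rec_seq_closed[OF assms] by auto
  have c: "i < d \<Longrightarrow> c i \<in> carrier R" for i using rec by (auto simp: lin_rec_seq_def)
  have q: "?q m \<in> carrier R" for m using rec_denom_closed[of c d] rec by (auto simp: lin_rec_seq_def)
  have q0: "?q 0 = \<one>" by (simp add: rec_denom_def)
  have "conv R ?q u (n + d) = (\<Oplus>i\<in>{..d}. ?q i \<otimes> u (n + d - i))"
    unfolding conv_def
    by (rule add.finprod_mono_neutral_cong_right) (use q u in \<open>auto simp: rec_denom_def\<close>)
  also have "{..d} = (\<lambda>i. d - i) ` {..d}"
  proof (intro subset_antisym subsetI)
    fix x assume "x \<in> {..d}"
    then show "x \<in> (\<lambda>i. d - i) ` {..d}" by (intro image_eqI[of _ _ "d - x"]) auto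
  qed auto
  also have "(\<Oplus>i\<in>(\<lambda>i. d - i) ` {..d}. ?q i \<otimes> u (n + d - i)) = (\<Oplus>i\<in>{..d}. ?q (d - i) \<otimes> u (n + d - (d - i)))"
    using q u by (intro finsum_reindex) (auto simp: inj_on_def)
  also have "\<dots> = (\<Oplus>i\<in>{..<Suc d}. ?q (d - i) \<otimes> u (n + d - (d - i)))"
    by (simp add: lessThan_Suc_atMost)
  also have "\<dots> = (\<Oplus>i\<in>{..<d}. ?q (d - i) \<otimes> u (n + d - (d - i))) \<oplus> u (n + d)"
    using q u q0 by (subst finsum_lessThan_Suc) auto
  also have "(\<Oplus>i\<in>{..<d}. ?q (d - i) \<otimes> u (n + d - (d - i))) = (\<Oplus>i\<in>{..<d}. \<ominus> \<one> \<otimes> (c i \<otimes> u (n + i)))"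
  proof (intro finsum_cong')
    fix i assume i: "i \<in> {..<d}"
    then have "n + d - (d - i) = n + i" "d - (d - i) = i" by auto
    then show "?q (d - i) \<otimes> u (n + d - (d - i)) = \<ominus> \<one> \<otimes> (c i \<otimes> u (n + i))"
      using i u c by (simp add: rec_denom_def l_minus)
  qed (use u c in auto)
  also have "\<dots> = \<ominus> \<one> \<otimes> (\<Oplus>i\<in>{..<d}. c i \<otimes> u (n + i))"
    using u c by (intro finsum_rdistr[symmetric]) auto
  also have "(\<Oplus>i\<in>{..<d}. c i \<otimes> u (n + i)) = u (n + d)"
    using rec by (simp add: lin_rec_seq_def)
  finally show ?thesis using u by (simp add: l_minus l_neg)
qed

end

section \<open>Inversion of the discrete Fourier transform\<close>

lemma (in field) pow_eq_one_imp_finsum_zero: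
  assumes "x \<in> carrier R" "x [^] (n::nat) = \<one>" "x \<noteq> \<one>"
  shows "(\<Oplus>y\<in>{..<n}. x [^] y) = \<zero>"
proof -
  have "(x \<ominus> \<one>) \<otimes> (\<Oplus>y\<in>{..<n}. x [^] y) = \<zero>"
    using geometric_finsum[OF assms(1), of n] assms by (simp add: r_neg minus_eq)
  moreover have "x \<ominus> \<one> \<noteq> \<zero>" using assms by (simp add: r_right_minus_eq)
  ultimately show ?thesis using assms by (subst (asm) integral_iff) auto
qed

text \<open>Orthogonality: after the sums are exchanged, \<open>f i\<close> is multiplied by the sum
  of the first \<open>h\<close> powers of \<open>r i = z [^] i \<otimes> w [^] m\<close>. This is an
  \<open>h\<close>-th root of unity, so the sum vanishes unless \<open>r i = \<one>\<close>, and
  since \<open>z\<close> has exact order \<open>h\<close> that happens for \<open>i = m\<close>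
  only.\<close>

lemma (in field) evalp_inverse_DFT:
  assumes f: "f \<in> UNIV \<rightarrow> carrier R" and z: "z \<in> carrier R" "w \<in> carrier R" "z \<otimes> w = \<one>"
    and h: "z [^] h = \<one>" "\<And>j. 0 < j \<Longrightarrow> j < h \<Longrightarrow> z [^] j \<noteq> \<one>" and m: "m < (h::nat)"
  shows "evalp R (\<lambda>y. evalp R f h (z [^] y)) h (w [^] m) = (\<Oplus>y\<in>{..<h}. \<one>) \<otimes> f m"
proof -
  have fc: "f i \<in> carrier R" for i using f by auto
  have zw: "z [^] j \<otimes> w [^] j = \<one>" for j :: nat
    using z by (metis nat_pow_one pow_mult_distrib m_comm)
  have wh: "w [^] h = \<one>" using zw[of h] h z by simp
  define r where "r i = z [^] i \<otimes> w [^] m" for i :: nat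
  have r: "r i \<in> carrier R" for i using z by (simp add: r_def)
  have rh: "r i [^] h = \<one>" for i
    using z h(1) wh by (simp add: r_def pow_mult_distrib m_comm nat_pow_pow)
      (metis mult.commute nat_pow_one nat_pow_pow r_one one_closed)
  have inj: "z [^] i \<noteq> z [^] j" if "i < j" "j < h" for i j :: nat
  proof
    assume "z [^] i = z [^] j"
    moreover have "z [^] j = z [^] (j - i) \<otimes> z [^] i"
      using that z by (simp add: nat_pow_mult)
    ultimately have "z [^] i \<otimes> w [^] i = z [^] (j - i) \<otimes> (z [^] i \<otimes> w [^] i)"
      using z by (metis m_assoc nat_pow_closed)
    then have "z [^] (j - i) = \<one>" using z by (simp add: zw)
    then show False using h(2)[of "j - i"] that by auto
  qed
  have r1: "r i \<noteq> \<one>" if "i < h" "i \<noteq> m" for i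
  proof
    assume "r i = \<one>"
    have "z [^] i = z [^] i \<otimes> (z [^] m \<otimes> w [^] m)" using z by (simp add: zw)
    also have "\<dots> = r i \<otimes> z [^] m" using z by (simp add: r_def m_ac)
    also have "\<dots> = z [^] m" using z \<open>r i = \<one>\<close> by simp
    finally show False using inj[of i m] inj[of m i] that m by (metis linorder_neqE_nat)
  qed
  have "evalp R (\<lambda>y. evalp R f h (z [^] y)) h (w [^] m) = (\<Oplus>y\<in>{..<h}. \<Oplus>i\<in>{..<h}. f i \<otimes> r i [^] y)"
    unfolding evalp_def
  proof (intro finsum_cong')
    fix y :: nat
    have "f i \<otimes> (z [^] y) [^] i \<otimes> (w [^] m) [^] y = f i \<otimes> r i [^] y" for i
    proof -
      have "(z [^] y) [^] i = (z [^] i) [^] y" using z by (simp add: nat_pow_pow mult.commute)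
      moreover have "r i [^] y = (z [^] i) [^] y \<otimes> (w [^] m) [^] y"
        unfolding r_def using z by (intro pow_mult_distrib m_comm) auto
      ultimately show ?thesis using z fc by (simp add: m_assoc)
    qed
    then show "(\<Oplus>i\<in>{..<h}. f i \<otimes> (z [^] y) [^] i) \<otimes> (w [^] m) [^] y = (\<Oplus>i\<in>{..<h}. f i \<otimes> r i [^] y)"
      using fc z r by (subst finsum_ldistr) (auto intro!: finsum_cong')
  qed (use fc z r in \<open>auto intro!: finsum_closed\<close>)
  also have "\<dots> = (\<Oplus>i\<in>{..<h}. \<Oplus>y\<in>{..<h}. f i \<otimes> r i [^] y)"
    using fc r by (intro finsum_swap) auto
  also have "\<dots> = (\<Oplus>i\<in>{..<h}. if i = m then (\<Oplus>y\<in>{..<h}. \<one>) \<otimes> f m else \<zero>)"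
  proof (intro finsum_cong')
    fix i assume i: "i \<in> {..<h}"
    have *: "(\<Oplus>y\<in>{..<h}. f i \<otimes> r i [^] y) = f i \<otimes> (\<Oplus>y\<in>{..<h}. r i [^] y)"
      using fc r by (intro finsum_rdistr[symmetric]) auto
    show "(\<Oplus>y\<in>{..<h}. f i \<otimes> r i [^] y) = (if i = m then (\<Oplus>y\<in>{..<h}. \<one>) \<otimes> f m else \<zero>)"
    proof (cases "i = m")
      case True
      then show ?thesis using * zw[of m] fc by (simp add: r_def m_comm)
    next
      case False
      then show ?thesis using * pow_eq_one_imp_finsum_zero[OF r rh r1] i fc by simp
    qed
  qed (use fc in auto)
  also have "\<dots> = (\<Oplus>y\<in>{..<h}. \<one>) \<otimes> f m"
    using m fc by (subst add.finprod_singleton_swap) auto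
  finally show ?thesis .
qed


text \<open>The transforms have length \<open>2 * 2 ^ k\<close>, so adding \<open>2 ^ k\<close> to
  an exponent is a change of sign. The order of the root is expressed in terms of ring operations,
  which keeps the multiplicative group out of the computations below.\<close>

locale fft_field = field R for R (structure) +
  fixes \<omega> :: 'a and k :: nat
  assumes root_closed: "\<omega> \<in> carrier R"
    and root_half: "\<omega> [^] ((2::nat) ^ k) = \<ominus> \<one>"
    and root_primitive: "0 < j \<Longrightarrow> j < 2 * 2 ^ k \<Longrightarrow> \<omega> [^] (j::nat) \<noteq> \<one>"
    and two_nonzero: "\<one> \<oplus> \<one> \<noteq> \<zero>"
begin

abbreviation "half \<equiv> inv (\<one> \<oplus> \<one>)"

lemma half_closed [simp]: "half \<in> carrier R"
  using two_nonzero by (simp add: field_Units)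

lemma half_mult: "(\<one> \<oplus> \<one>) \<otimes> half = \<one>"
  using two_nonzero by (simp add: field_Units)

lemma half_pow: "(\<one> \<oplus> \<one>) [^] (m::nat) \<otimes> half [^] m = \<one>"
  by (metis half_mult half_closed nat_pow_one pow_mult_distrib m_comm a_closed one_closed)

lemma half_double:
  assumes "x \<in> carrier R"
  shows "half \<otimes> (x \<oplus> x) = x"
proof -
  have "half \<otimes> (x \<oplus> x) = ((\<one> \<oplus> \<one>) \<otimes> half) \<otimes> x"
    using assms half_closed by (simp only: l_distr r_distr m_ac one_closed a_closed l_one m_closed)
  then show ?thesis using assms half_mult by simp
qed

lemma root_add_half: "\<omega> [^] (y + 2 ^ k) = \<ominus> (\<omega> [^] (y::nat))"
  using root_closed by (simp flip: nat_pow_mult add: root_half r_minus)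

lemma root_pow: "\<omega> [^] ((2::nat) * 2 ^ k) = \<one>"
  using root_closed by (simp only: mult_2 nat_pow_mult[symmetric] root_half) (simp add: l_minus)

lemma root_mod: "\<omega> [^] (y mod (2 * 2 ^ k)) = \<omega> [^] (y::nat)"
proof -
  have "\<omega> [^] y = \<omega> [^] (2 * 2 ^ k * (y div (2 * 2 ^ k)) + y mod (2 * 2 ^ k))" by simp
  also have "\<dots> = (\<omega> [^] ((2::nat) * 2 ^ k)) [^] (y div (2 * 2 ^ k)) \<otimes> \<omega> [^] (y mod (2 * 2 ^ k))"
    using root_closed by (simp only: nat_pow_mult[symmetric] nat_pow_pow)
  also have "\<dots> = \<omega> [^] (y mod (2 * 2 ^ k))" using root_closed by (simp add: root_pow)
  finally show ?thesis ..
qed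

lemma root_inverse: "(y::nat) \<le> 2 * 2 ^ k \<Longrightarrow> \<omega> [^] (2 * 2 ^ k - y) \<otimes> \<omega> [^] y = \<one>"
  using root_closed by (simp add: nat_pow_mult root_pow)

text \<open>The substitution of \<open>-x\<close> for \<open>x\<close> swaps the factors of
  \<open>q(-x) q(x)\<close>, so an odd coefficient equals its own negative. It is zero because one
  half exists.\<close>

lemma conv_alt_odd:
  assumes q: "q \<in> UNIV \<rightarrow> carrier R" and "odd m"
  shows "conv R (alt R q) q m = \<zero>"
proof -
  define V where "V = conv R (alt R q) q"
  have V: "V m \<in> carrier R" using conv_closed[OF alt_closed q] q by (auto simp: V_def)
  have "alt R V = conv R (alt R (alt R q)) (alt R q)"
    unfolding V_def using q by (simp add: conv_alt alt_closed)
  also have "\<dots> = V" unfolding V_def using q by (simp add: alt_alt conv_comm alt_closed)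
  finally have "\<ominus> V m = V m" using \<open>odd m\<close> by (metis alt_def)
  then have "V m \<oplus> V m = \<zero>" using V by (metis r_neg)
  then show ?thesis using half_double[OF V] V by (simp add: V_def)
qed

section \<open>One halving step of the index, on the level of polynomials\<close>

context
  fixes p q w :: "nat \<Rightarrow> 'a" and b d :: nat
  assumes p: "p \<in> UNIV \<rightarrow> carrier R" and q: "q \<in> UNIV \<rightarrow> carrier R"
    and w: "w \<in> UNIV \<rightarrow> carrier R"
    and p_supp: "\<And>m. d \<le> m \<Longrightarrow> p m = \<zero>" and q_supp: "\<And>m. d < m \<Longrightarrow> q m = \<zero>"
    and q_0: "q 0 = \<one>" and pqw: "conv R q w = p"
    and b: "b < 2" and d: "1 \<le> d" "d < 2 ^ k"
begin

lemma step_closed: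
  "conv R (alt R q) q m \<in> carrier R" "conv R (alt R q) p m \<in> carrier R"
  using conv_closed[OF alt_closed[OF q] q] conv_closed[OF alt_closed[OF q] p] by auto

lemma alt_q_supp: "d < m \<Longrightarrow> alt R q m = \<zero>"
  by (simp add: alt_def q_supp)

text \<open>The degree bounds are invariant: \<open>q(-x) q(x)\<close> has degree at most
  \<open>2 * d\<close> and \<open>q(-x) p(x)\<close> at most \<open>2 * d - 1\<close>, and
  decimation halves the indices.\<close>

lemma step_supp:
  "d < m \<Longrightarrow> conv R (alt R q) q (2 * m) = \<zero>"
  "d \<le> m \<Longrightarrow> conv R (alt R q) p (2 * m + b) = \<zero>"
proof -
  show "d < m \<Longrightarrow> conv R (alt R q) q (2 * m) = \<zero>"
    by (rule conv_eq_zero[OF alt_closed[OF q] q, where a = d and b = d]) (auto simp: q_supp alt_q_supp)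
  show "d \<le> m \<Longrightarrow> conv R (alt R q) p (2 * m + b) = \<zero>"
    by (rule conv_eq_zero[OF alt_closed[OF q] p, where a = d and b = "d - 1"])
      (use d in \<open>auto simp: p_supp alt_q_supp\<close>)
qed

lemma step_0: "conv R (alt R q) q 0 = \<one>"
  by (simp add: conv_def alt_def q_0)

text \<open>Multiplying \<open>q w = p\<close> by \<open>q(-x)\<close> puts an even factor in front
  of \<open>w\<close>, and \<open>conv_decimate\<close> applies.\<close>

lemma step_conv:
  "conv R (\<lambda>m. conv R (alt R q) q (2 * m)) (\<lambda>m. w (2 * m + b)) = (\<lambda>m. conv R (alt R q) p (2 * m + b))"
proof
  fix m
  have "conv R (alt R q) p (2 * m + b) = conv R (conv R (alt R q) q) w (2 * m + b)"
    using q w by (simp add: pqw[symmetric] conv_assoc alt_closed)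
  also have "\<dots> = conv R (\<lambda>m. conv R (alt R q) q (2 * m)) (\<lambda>m. w (2 * m + b)) m"
    using conv_closed[OF alt_closed[OF q] q] w b q by (intro conv_decimate) (auto simp: conv_alt_odd)
  finally show "conv R (\<lambda>m. conv R (alt R q) q (2 * m)) (\<lambda>m. w (2 * m + b)) m = conv R (alt R q) p (2 * m + b)" ..
qed

lemma evalp_step_numer:
  fixes y :: nat
  shows "evalp R (conv R (alt R q) p) (2 * 2 ^ k) (\<omega> [^] y) =
   evalp R q (2 * 2 ^ k) (\<omega> [^] (y + 2 ^ k)) \<otimes> evalp R p (2 * 2 ^ k) (\<omega> [^] y)"
proof -
  have "evalp R (conv R (alt R q) p) (2 * 2 ^ k) (\<omega> [^] y) =
    evalp R (alt R q) (2 * 2 ^ k) (\<omega> [^] y) \<otimes> evalp R p (2 * 2 ^ k) (\<omega> [^] y)"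
    using d root_closed q p alt_q_supp p_supp
    by (intro evalp_conv[where a = d and b = d]) (auto simp: alt_closed)
  then show ?thesis using root_closed q by (simp add: evalp_alt root_add_half)
qed

lemma evalp_step_denom:
  fixes y :: nat
  shows "evalp R (\<lambda>m. conv R (alt R q) q (2 * m)) (2 ^ k) (\<omega> [^] y \<otimes> \<omega> [^] y) =
   evalp R q (2 * 2 ^ k) (\<omega> [^] (y + 2 ^ k)) \<otimes> evalp R q (2 * 2 ^ k) (\<omega> [^] y)"
proof -
  let ?V = "conv R (alt R q) q"
  have odd: "evalp R (\<lambda>i. ?V (2 * i + 1)) (2 ^ k) (\<omega> [^] y \<otimes> \<omega> [^] y) = \<zero>"
    using evalp_extend[of "\<lambda>i. ?V (2 * i + 1)" "\<omega> [^] y \<otimes> \<omega> [^] y" 0 "2 ^ k"] root_closed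
      conv_alt_odd[OF q] by simp
  have "evalp R ?V (2 * 2 ^ k) (\<omega> [^] y) =
    evalp R (alt R q) (2 * 2 ^ k) (\<omega> [^] y) \<otimes> evalp R q (2 * 2 ^ k) (\<omega> [^] y)"
    using d root_closed q alt_q_supp q_supp
    by (intro evalp_conv[where a = d and b = d]) (auto simp: alt_closed)
  then have "evalp R ?V (2 * 2 ^ k) (\<omega> [^] y) =
    evalp R q (2 * 2 ^ k) (\<omega> [^] (y + 2 ^ k)) \<otimes> evalp R q (2 * 2 ^ k) (\<omega> [^] y)"
    using root_closed q by (simp add: evalp_alt root_add_half)
  then show ?thesis
    using odd root_closed step_closed by (subst (asm) evalp_even_odd) (auto simp: Pi_def)
qed

text \<open>The values at \<open>x\<close> and \<open>-x\<close> determine the even part as half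
  their sum, and the odd part as half their difference divided by \<open>x\<close>. Division by
  \<open>\<omega> [^] y\<close> is expressed as multiplication by the power of exponent
  \<open>2 * 2 ^ k - y\<close>, which a program takes from its table of powers. The bound on
  \<open>y\<close> keeps this subtraction of natural numbers exact.\<close>

lemma evalp_step_numer_part:
  fixes y :: nat
  defines "u \<equiv> (\<lambda>y. evalp R (conv R (alt R q) p) (2 * 2 ^ k) (\<omega> [^] y))"
  assumes "y < 2 * 2 ^ k"
  shows "evalp R (\<lambda>m. conv R (alt R q) p (2 * m + b)) (2 ^ k) (\<omega> [^] y \<otimes> \<omega> [^] y) =
    (if b = 0 then half \<otimes> (u y \<oplus> u (y + 2 ^ k))
     else \<omega> [^] (2 * 2 ^ k - y) \<otimes> (half \<otimes> (u y \<ominus> u (y + 2 ^ k))))"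
proof -
  let ?x = "\<omega> [^] y"
  have x: "?x \<in> carrier R" using root_closed by simp
  define E where "E c = evalp R (\<lambda>m. conv R (alt R q) p (2 * m + c)) (2 ^ k) (?x \<otimes> ?x)" for c
  have E: "E c \<in> carrier R" for c using x step_closed by (auto simp: E_def)
  have k: "(2::nat) * 2 ^ k = 2 * 2 ^ k" by (simp add:)
  have U: "conv R (alt R q) p \<in> UNIV \<rightarrow> carrier R" using step_closed by auto
  have u: "u y = E 0 \<oplus> ?x \<otimes> E 1"
    unfolding u_def E_def using evalp_even_odd[OF U x] by simp
  have u': "u (y + 2 ^ k) = E 0 \<ominus> ?x \<otimes> E 1"
    unfolding u_def root_add_half E_def using evalp_even_odd[OF U, of "\<ominus> ?x"] x step_closed
    by (simp add: l_minus r_minus minus_eq Pi_def)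
  have s: "u y \<oplus> u (y + 2 ^ k) = E 0 \<oplus> E 0"
    unfolding u u' using x E[of 0] E[of 1] by algebra
  have t: "u y \<ominus> u (y + 2 ^ k) = ?x \<otimes> E 1 \<oplus> ?x \<otimes> E 1"
    unfolding u u' using x E[of 0] E[of 1] by algebra
  have "\<omega> [^] (2 * 2 ^ k - y) \<otimes> (?x \<otimes> E 1) = E 1"
    using x E[of 1] root_closed root_inverse[of y] assms(2) by (simp add: m_assoc[symmetric])
  moreover have "b = 0 \<or> b = 1" using b by auto
  ultimately have "E b = (if b = 0 then half \<otimes> (u y \<oplus> u (y + 2 ^ k))
     else \<omega> [^] (2 * 2 ^ k - y) \<otimes> (half \<otimes> (u y \<ominus> u (y + 2 ^ k))))"
    unfolding s t using x E by (auto simp: half_double)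
  then show ?thesis by (simp add: E_def)
qed

end

end

section \<open>Values computed by straight-line programs\<close>

lemma exec_append: "exec K (is @ js) mem = Option.bind (exec K is mem) (exec K js)"
  by (induction K "is" mem rule: exec.induct) (auto split: option.splits)

lemma exec_Some_append: "exec K is mem = Some mem' \<Longrightarrow> \<exists>t. mem' = mem @ t \<and> length t = length is"
  by (induction K "is" mem rule: exec.induct) (fastforce split: option.splits if_splits)+

text \<open>
  A program has to work for all instances \<open>i \<in> I\<close> of the problem at once. A value is therefore a
  function of the instance, and a value counts as computed only if it sits at the same address for
  every instance.
\<close>

locale slp_family =
  fixes I :: "'i set" and K :: "'i \<Rightarrow> ('a, 'b) ring_scheme" and inp :: "'i \<Rightarrow> 'a list" and L :: nat
  assumes length_inp: "i \<in> I \<Longrightarrow> length (inp i) = L"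
    and field_K: "i \<in> I \<Longrightarrow> field (K i)"
begin

definition valid :: "instr list \<Rightarrow> bool" where
  "valid P \<longleftrightarrow> (\<forall>i\<in>I. exec (K i) P (inp i) \<noteq> None)"

definition mem :: "instr list \<Rightarrow> 'i \<Rightarrow> 'a list" where
  "mem P i = the (exec (K i) P (inp i))"

definition vals :: "instr list \<Rightarrow> ('i \<Rightarrow> 'a) set" where
  "vals P = {v. \<exists>a. \<forall>i\<in>I. a < length (mem P i) \<and> mem P i ! a = v i}"

text \<open>Programs only grow at the end. Addresses assigned earlier remain correct, so computed
  values persist (\<open>vals_mono\<close>), and the bounds \<open>c\<close> add up along a chain of
  phases (\<open>ext_trans\<close>).\<close>

definition ext :: "nat \<Rightarrow> instr list \<Rightarrow> instr list \<Rightarrow> bool" where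
  "ext c P P' \<longleftrightarrow> (\<exists>js. P' = P @ js \<and> length js \<le> c \<and> valid P')"

lemma ext_validD: "ext c P P' \<Longrightarrow> valid P'"
  by (auto simp: ext_def)

lemma ext_refl: "valid P \<Longrightarrow> ext 0 P P"
  by (simp add: ext_def)

lemma ext_trans: "ext c P Q \<Longrightarrow> ext c' Q S \<Longrightarrow> ext (c + c') P S"
  by (force simp: ext_def)

lemma ext_le: "ext c P Q \<Longrightarrow> c \<le> c' \<Longrightarrow> ext c' P Q"
  by (force simp: ext_def)

lemma vals_cong: "v \<in> vals P \<Longrightarrow> (\<And>i. i \<in> I \<Longrightarrow> w i = v i) \<Longrightarrow> w \<in> vals P"
  by (auto simp: vals_def)

lemma length_mem: "valid P \<Longrightarrow> i \<in> I \<Longrightarrow> length (mem P i) = L + length P"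
  using exec_Some_append[of "K i" P "inp i"] length_inp[of i] by (fastforce simp: valid_def mem_def)

lemma mem_append:
  assumes "valid (P @ js)" "i \<in> I"
  shows "\<exists>t. mem (P @ js) i = mem P i @ t"
proof -
  obtain m' where m': "exec (K i) (P @ js) (inp i) = Some m'"
    using assms by (auto simp: valid_def)
  then obtain m where "exec (K i) P (inp i) = Some m" "exec (K i) js m = Some m'"
    by (auto simp: exec_append Option.bind_eq_Some_conv)
  with m' show ?thesis using exec_Some_append[of "K i" js m] by (auto simp: mem_def)
qed

lemma vals_mono:
  assumes "ext c P P'" "v \<in> vals P"
  shows "v \<in> vals P'"
proof -
  from assms obtain js where js: "P' = P @ js" "valid P'" by (auto simp: ext_def)
  from assms obtain a where "\<forall>i\<in>I. a < length (mem P i) \<and> mem P i ! a = v i" by (auto simp: vals_def)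
  then have "\<forall>i\<in>I. a < length (mem P' i) \<and> mem P' i ! a = v i"
    using mem_append[of P js] js by (force simp: nth_append)
  then show ?thesis by (auto simp: vals_def)
qed

lemma ext_op:
  assumes "valid P" "v \<in> vals P" "w \<in> vals P"
    and r: "\<And>i. i \<in> I \<Longrightarrow> apply_op (K i) f (v i) (w i) = Some (r i)"
  shows "\<exists>P'. ext 1 P P' \<and> length P' = Suc (length P) \<and> r \<in> vals P'"
proof -
  obtain a where a: "\<And>i. i \<in> I \<Longrightarrow> a < length (mem P i) \<and> mem P i ! a = v i"
    using assms by (auto simp: vals_def)
  obtain b where b: "\<And>i. i \<in> I \<Longrightarrow> b < length (mem P i) \<and> mem P i ! b = w i"
    using assms by (auto simp: vals_def)
  let ?P = "P @ [(f, a, b)]"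
  have ex: "exec (K i) ?P (inp i) = Some (mem P i @ [r i])" if "i \<in> I" for i
    using assms(1) a[OF that] b[OF that] r[OF that] that
    by (auto simp: exec_append valid_def mem_def)
  then have "valid ?P" by (auto simp: valid_def)
  \<comment> \<open>Every instruction appends exactly one cell, so the address of the new value
    depends on the program alone and is common to all instances.\<close>
  moreover have "\<forall>i\<in>I. L + length P < length (mem ?P i) \<and> mem ?P i ! (L + length P) = r i"
    using ex length_mem[OF assms(1)] by (auto simp: mem_def[of ?P] nth_append)
  then have "r \<in> vals ?P" by (auto simp: vals_def)
  ultimately show ?thesis by (intro exI[of _ ?P]) (auto simp: ext_def)
qed

text \<open>Values that are one instruction away. The property is inherited by longer programs, so a
  whole layer of mutually independent operations can be appended by \<open>ext_opvals\<close> at one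
  instruction each.\<close>

definition opval :: "instr list \<Rightarrow> ('i \<Rightarrow> 'a) \<Rightarrow> bool" where
  "opval P r \<longleftrightarrow> (\<exists>f v w. v \<in> vals P \<and> w \<in> vals P \<and>
     (\<forall>i\<in>I. apply_op (K i) f (v i) (w i) = Some (r i)))"

lemma opval_add:
  "v \<in> vals P \<Longrightarrow> w \<in> vals P \<Longrightarrow> (\<And>i. i \<in> I \<Longrightarrow> r i = v i \<oplus>\<^bsub>K i\<^esub> w i) \<Longrightarrow> opval P r"
  unfolding opval_def by (intro exI[of _ Add] exI[of _ v] exI[of _ w]) simp

lemma opval_sub:
  "v \<in> vals P \<Longrightarrow> w \<in> vals P \<Longrightarrow> (\<And>i. i \<in> I \<Longrightarrow> r i = v i \<ominus>\<^bsub>K i\<^esub> w i) \<Longrightarrow> opval P r"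
  unfolding opval_def by (intro exI[of _ Sub] exI[of _ v] exI[of _ w]) simp

lemma opval_mult:
  "v \<in> vals P \<Longrightarrow> w \<in> vals P \<Longrightarrow> (\<And>i. i \<in> I \<Longrightarrow> r i = v i \<otimes>\<^bsub>K i\<^esub> w i) \<Longrightarrow> opval P r"
  unfolding opval_def by (intro exI[of _ Mul] exI[of _ v] exI[of _ w]) simp

lemma opval_div:
  "v \<in> vals P \<Longrightarrow> w \<in> vals P \<Longrightarrow>
   (\<And>i. i \<in> I \<Longrightarrow> w i \<noteq> \<zero>\<^bsub>K i\<^esub> \<and> r i = v i \<otimes>\<^bsub>K i\<^esub> inv\<^bsub>K i\<^esub> w i) \<Longrightarrow> opval P r"
  unfolding opval_def by (intro exI[of _ Div] exI[of _ v] exI[of _ w]) simp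

lemma opval_mono: "ext c P P' \<Longrightarrow> opval P r \<Longrightarrow> opval P' r"
  unfolding opval_def by (metis vals_mono)

lemma ext_opval: "valid P \<Longrightarrow> opval P r \<Longrightarrow> \<exists>P'. ext 1 P P' \<and> r \<in> vals P'"
  unfolding opval_def by (metis ext_op)

lemma ext_opvals:
  assumes "valid P" "\<And>j. j < m \<Longrightarrow> opval P (r j)"
  shows "\<exists>P'. ext m P P' \<and> (\<forall>j<m. r j \<in> vals P')"
  using assms(2)
proof (induction m)
  case 0
  then show ?case using ext_refl[OF assms(1)] by auto
next
  case (Suc m)
  then obtain P' where P': "ext m P P'" "\<forall>j<m. r j \<in> vals P'" by auto
  then obtain P'' where P'': "ext 1 P' P''" "r m \<in> vals P''"
    using ext_opval[of P' "r m"] Suc.prems[of m] opval_mono ext_validD by blast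
  then show ?case
    using P' ext_trans[OF P'(1) P''(1)] vals_mono[OF P''(1)] by (intro exI[of _ P'']) (auto simp: less_Suc_eq)
qed

text \<open>Serves to compute the tables of powers of the root and of one half.\<close>

lemma ext_iterate:
  assumes "valid P" "r 0 \<in> vals P" "v \<in> vals P" "\<And>j i. i \<in> I \<Longrightarrow> r (Suc j) i = r j i \<otimes>\<^bsub>K i\<^esub> v i"
  shows "\<exists>P'. ext m P P' \<and> (\<forall>j\<le>m. r j \<in> vals P')"
proof (induction m)
  case 0
  then show ?case using ext_refl[OF assms(1)] assms by auto
next
  case (Suc m)
  then obtain P' where P': "ext m P P'" "\<forall>j\<le>m. r j \<in> vals P'" by auto
  then have "opval P' (r (Suc m))"
    using assms vals_mono[OF P'(1)] by (intro opval_mult[of "r m" _ v]) auto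
  then obtain P'' where P'': "ext 1 P' P''" "r (Suc m) \<in> vals P''"
    using ext_opval[of P'] P' ext_validD by blast
  then show ?case
    using P' ext_trans[OF P'(1) P''(1)] vals_mono[OF P''(1)] by (intro exI[of _ P'']) (auto simp: le_Suc_eq)
qed

text \<open>
  Asymptotic equivalence bounds the cost from below as well, so programs are padded with idle
  additions to a length that is known exactly.
\<close>

lemma ext_pad:
  assumes "ext c P P'" "v \<in> vals P" "w \<in> vals P'"
  shows "\<exists>P''. length P'' = length P + c \<and> valid P'' \<and> w \<in> vals P''"
proof -
  have "\<exists>Q. length Q = length P' + m \<and> valid Q \<and> ext m P' Q" for m
  proof (induction m)
    case 0
    then show ?case using ext_validD[OF assms(1)] ext_refl by auto
  next
    case (Suc m)
    then obtain Q where Q: "length Q = length P' + m" "valid Q" "ext m P' Q" by auto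
    have v: "v \<in> vals Q" using vals_mono[OF Q(3) vals_mono[OF assms(1,2)]] .
    show ?case
      using ext_op[OF Q(2) v v, of Add "\<lambda>i. v i \<oplus>\<^bsub>K i\<^esub> v i"] ext_trans[OF Q(3), of 1] Q(1) ext_validD
      by fastforce
  qed
  moreover have "length P' \<le> length P + c" using assms(1) by (auto simp: ext_def)
  ultimately obtain Q where "length Q = length P + c" "valid Q" "ext (length P + c - length P') P' Q"
    by (metis le_add_diff_inverse)
  then show ?thesis using vals_mono assms(3) by blast
qed

end

section \<open>Fourier transforms as programs\<close>

fun fft_ops :: "nat \<Rightarrow> nat" where
  "fft_ops 0 = 0"
| "fft_ops (Suc m) = 2 * fft_ops m + 3 * 2 ^ m"

text \<open>All powers of \<open>z\<close> are assumed to be in memory, so each butterfly costs just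
  its multiplication, addition and subtraction; this is the summand \<open>3 * 2 ^ m\<close> in
  \<open>fft_ops\<close>. The condition on the half power of \<open>z\<close> passes to
  \<open>z2\<close>, the square of \<open>z\<close>, at half the length, which carries the
  recursion.\<close>

lemma (in slp_family) ext_fft:
  assumes "valid P" "\<And>i. i \<in> I \<Longrightarrow> f i \<in> UNIV \<rightarrow> carrier (K i)"
    and "\<And>i. i \<in> I \<Longrightarrow> z i \<in> carrier (K i)"
    and "\<And>i. i \<in> I \<Longrightarrow> 0 < m \<Longrightarrow> z i [^]\<^bsub>K i\<^esub> ((2::nat) ^ (m - 1)) = \<ominus>\<^bsub>K i\<^esub> \<one>\<^bsub>K i\<^esub>"
    and "\<And>j::nat. (\<lambda>i. z i [^]\<^bsub>K i\<^esub> j) \<in> vals P"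
    and "\<And>j. j < 2 ^ m \<Longrightarrow> (\<lambda>i. f i j) \<in> vals P"
  shows "\<exists>P'. ext (fft_ops m) P P' \<and> (\<forall>y<2 ^ m. (\<lambda>i. evalp (K i) (f i) (2 ^ m) (z i [^]\<^bsub>K i\<^esub> (y::nat))) \<in> vals P')"
  using assms
proof (induction m arbitrary: f z P)
  case 0
  have "evalp (K i) (f i) 1 (z i [^]\<^bsub>K i\<^esub> (0::nat)) = f i 0" if i: "i \<in> I" for i
  proof -
    interpret field "K i" using field_K[OF i] .
    have "f i 0 \<in> carrier (K i)" "f i \<in> UNIV \<rightarrow> carrier (K i)" using "0.prems"(2)[OF i] by auto
    then show ?thesis using evalp_Suc[of "f i" "\<one>\<^bsub>K i\<^esub>" 0] by simp
  qed
  then have "(\<lambda>i. evalp (K i) (f i) 1 (z i [^]\<^bsub>K i\<^esub> (0::nat))) \<in> vals P"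
    by - (rule vals_cong[OF "0.prems"(6)[of 0]], auto)
  then show ?case using ext_refl[OF "0.prems"(1)] by auto
next
  case (Suc m)
  define z2 where "z2 i = z i \<otimes>\<^bsub>K i\<^esub> z i" for i
  define fe where "fe i j = f i (2 * j)" for i j
  define fo where "fo i j = f i (2 * j + 1)" for i j
  have fc: "fe i \<in> UNIV \<rightarrow> carrier (K i)" "fo i \<in> UNIV \<rightarrow> carrier (K i)" if "i \<in> I" for i
    using Suc.prems(2)[OF that] by (auto simp: fe_def fo_def)
  have z2c: "z2 i \<in> carrier (K i)" if i: "i \<in> I" for i
  proof -
    interpret field "K i" using field_K[OF i] .
    show ?thesis using Suc.prems(3)[OF i] by (simp add: z2_def)
  qed
  have z2_pow: "z2 i [^]\<^bsub>K i\<^esub> j = z i [^]\<^bsub>K i\<^esub> (2 * j)" if i: "i \<in> I" for i and j :: nat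
  proof -
    interpret field "K i" using field_K[OF i] .
    have "z2 i = z i [^]\<^bsub>K i\<^esub> (2::nat)" using Suc.prems(3)[OF i] by (simp add: z2_def numeral_2_eq_2)
    then show ?thesis using Suc.prems(3)[OF i] by (simp add: nat_pow_pow)
  qed
  have z2_half: "z2 i [^]\<^bsub>K i\<^esub> ((2::nat) ^ (m - 1)) = \<ominus>\<^bsub>K i\<^esub> \<one>\<^bsub>K i\<^esub>" if "i \<in> I" "0 < m" for i
    using Suc.prems(4)[of i] that by (cases m) (auto simp: z2_pow)
  have z2_vals: "(\<lambda>i. z2 i [^]\<^bsub>K i\<^esub> j) \<in> vals P" for j :: nat
    by (rule vals_cong[OF Suc.prems(5)[of "2 * j"]]) (simp add: z2_pow)
  have f_vals: "(\<lambda>i. fe i j) \<in> vals P" "(\<lambda>i. fo i j) \<in> vals P" if "j < 2 ^ m" for j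
    using that Suc.prems(6) by (auto simp: fe_def fo_def)
  have "\<exists>P'. ext (fft_ops m) P P' \<and> (\<forall>y<2 ^ m. (\<lambda>i. evalp (K i) (fe i) (2 ^ m) (z2 i [^]\<^bsub>K i\<^esub> (y::nat))) \<in> vals P')"
    using fc z2c z2_half z2_vals f_vals Suc.prems(1) by (intro Suc.IH) auto
  then obtain P1 where P1: "ext (fft_ops m) P P1"
    "\<And>y::nat. y < 2 ^ m \<Longrightarrow> (\<lambda>i. evalp (K i) (fe i) (2 ^ m) (z2 i [^]\<^bsub>K i\<^esub> y)) \<in> vals P1" by auto
  have "\<exists>P'. ext (fft_ops m) P1 P' \<and> (\<forall>y<2 ^ m. (\<lambda>i. evalp (K i) (fo i) (2 ^ m) (z2 i [^]\<^bsub>K i\<^esub> (y::nat))) \<in> vals P')"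
    using fc z2c z2_half vals_mono[OF P1(1) z2_vals] vals_mono[OF P1(1) f_vals(2)] ext_validD[OF P1(1)]
    by (intro Suc.IH) auto
  then obtain P2 where P2: "ext (fft_ops m) P1 P2"
    "\<And>y::nat. y < 2 ^ m \<Longrightarrow> (\<lambda>i. evalp (K i) (fo i) (2 ^ m) (z2 i [^]\<^bsub>K i\<^esub> y)) \<in> vals P2" by auto
  define E where "E y i = evalp (K i) (fe i) (2 ^ m) (z2 i [^]\<^bsub>K i\<^esub> (y::nat))" for y i
  define T where "T y i = z i [^]\<^bsub>K i\<^esub> y \<otimes>\<^bsub>K i\<^esub> evalp (K i) (fo i) (2 ^ m) (z2 i [^]\<^bsub>K i\<^esub> (y::nat))" for y i
  have "opval P2 (T y)" if "y < 2 ^ m" for y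
    using P2(2)[OF that] vals_mono[OF P2(1) vals_mono[OF P1(1) Suc.prems(5)[of y]]]
    by (intro opval_mult) (auto simp: T_def)
  from ext_opvals[of P2 "2 ^ m" T, OF ext_validD[OF P2(1)] this] obtain P3 where P3: "ext (2 ^ m) P2 P3"
    "\<forall>y<2 ^ m. T y \<in> vals P3" by blast
  have E3: "E y \<in> vals P3" if "y < 2 ^ m" for y
    using vals_mono[OF P3(1) vals_mono[OF P2(1) P1(2)[OF that]]] by (simp add: E_def[abs_def])
  have "opval P3 (\<lambda>i. E y i \<oplus>\<^bsub>K i\<^esub> T y i)" if "y < 2 ^ m" for y
    using P3(2) E3 that by (intro opval_add[of "E y" _ "T y"]) auto
  from ext_opvals[of P3 "2 ^ m" "\<lambda>y i. E y i \<oplus>\<^bsub>K i\<^esub> T y i", OF ext_validD[OF P3(1)] this] obtain P4 where P4: "ext (2 ^ m) P3 P4"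
    "\<forall>y<2 ^ m. (\<lambda>i. E y i \<oplus>\<^bsub>K i\<^esub> T y i) \<in> vals P4" by blast
  have "opval P4 (\<lambda>i. E y i \<ominus>\<^bsub>K i\<^esub> T y i)" if "y < 2 ^ m" for y
    using P3(2) E3 that vals_mono[OF P4(1)] by (intro opval_sub[of "E y" _ "T y"]) auto
  from ext_opvals[of P4 "2 ^ m" "\<lambda>y i. E y i \<ominus>\<^bsub>K i\<^esub> T y i", OF ext_validD[OF P4(1)] this] obtain P5 where P5: "ext (2 ^ m) P4 P5"
    "\<forall>y<2 ^ m. (\<lambda>i. E y i \<ominus>\<^bsub>K i\<^esub> T y i) \<in> vals P5" by blast
  \<comment> \<open>The points of index \<open>y\<close> and \<open>y + 2 ^ m\<close> are negatives
    of each other. They have the same square and hence share both half-length values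
    \<open>E y\<close> and the product \<open>T y\<close> up to sign.\<close>
  have low: "evalp (K i) (f i) (2 ^ Suc m) (z i [^]\<^bsub>K i\<^esub> y) = E y i \<oplus>\<^bsub>K i\<^esub> T y i"
    and high: "evalp (K i) (f i) (2 ^ Suc m) (z i [^]\<^bsub>K i\<^esub> (y + 2 ^ m)) = E y i \<ominus>\<^bsub>K i\<^esub> T y i"
    if i: "i \<in> I" for i and y :: nat
  proof -
    interpret field "K i" using field_K[OF i] .
    have zc: "z i \<in> carrier (K i)" using Suc.prems(3)[OF i] .
    have sq: "z i [^]\<^bsub>K i\<^esub> y \<otimes>\<^bsub>K i\<^esub> z i [^]\<^bsub>K i\<^esub> y = z2 i [^]\<^bsub>K i\<^esub> y"
      using zc by (simp add: z2_pow[OF i] nat_pow_mult mult_2)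
    have eo: "evalp (K i) (f i) (2 ^ Suc m) x = evalp (K i) (fe i) (2 ^ m) (x \<otimes>\<^bsub>K i\<^esub> x) \<oplus>\<^bsub>K i\<^esub>
        x \<otimes>\<^bsub>K i\<^esub> evalp (K i) (fo i) (2 ^ m) (x \<otimes>\<^bsub>K i\<^esub> x)" if "x \<in> carrier (K i)" for x
      using evalp_even_odd[OF Suc.prems(2)[OF i] that, of "2 ^ m"] by (simp add: fe_def[abs_def] fo_def[abs_def])
    show "evalp (K i) (f i) (2 ^ Suc m) (z i [^]\<^bsub>K i\<^esub> y) = E y i \<oplus>\<^bsub>K i\<^esub> T y i"
      using zc by (subst eo) (auto simp: E_def T_def sq)
    have "z i [^]\<^bsub>K i\<^esub> (y + 2 ^ m) = z i [^]\<^bsub>K i\<^esub> y \<otimes>\<^bsub>K i\<^esub> (\<ominus>\<^bsub>K i\<^esub> \<one>\<^bsub>K i\<^esub>)"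
      using Suc.prems(4)[OF i] zc by (simp flip: nat_pow_mult)
    then have neg: "z i [^]\<^bsub>K i\<^esub> (y + 2 ^ m) = \<ominus>\<^bsub>K i\<^esub> (z i [^]\<^bsub>K i\<^esub> y)"
      using zc by (simp add: r_minus)
    show "evalp (K i) (f i) (2 ^ Suc m) (z i [^]\<^bsub>K i\<^esub> (y + 2 ^ m)) = E y i \<ominus>\<^bsub>K i\<^esub> T y i"
      unfolding neg using zc z2c[OF i] fc[OF i]
      by (subst eo) (auto simp: E_def T_def sq l_minus r_minus minus_eq)
  qed
  have "(\<lambda>i. evalp (K i) (f i) (2 ^ Suc m) (z i [^]\<^bsub>K i\<^esub> y)) \<in> vals P5" if "y < 2 ^ Suc m" for y :: nat
  proof (cases "y < 2 ^ m")
    case True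
    then have "(\<lambda>i. E y i \<oplus>\<^bsub>K i\<^esub> T y i) \<in> vals P5" using P4(2) vals_mono[OF P5(1)] by blast
    then show ?thesis by (rule vals_cong) (rule low)
  next
    case False
    then have y: "y - 2 ^ m < 2 ^ m" "y = (y - 2 ^ m) + 2 ^ m" using that by auto
    have "(\<lambda>i. E (y - 2 ^ m) i \<ominus>\<^bsub>K i\<^esub> T (y - 2 ^ m) i) \<in> vals P5" using P5(2) y(1) by blast
    then show ?thesis
    proof (rule vals_cong)
      fix i assume "i \<in> I"
      then show "evalp (K i) (f i) (2 ^ Suc m) (z i [^]\<^bsub>K i\<^esub> y) = E (y - 2 ^ m) i \<ominus>\<^bsub>K i\<^esub> T (y - 2 ^ m) i"
        using high[of i "y - 2 ^ m"] y(2) by simp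
    qed
  qed
  moreover have "ext (fft_ops (Suc m)) P P5"
    by (rule ext_le[OF ext_trans[OF ext_trans[OF ext_trans[OF ext_trans[OF P1(1) P2(1)] P3(1)] P4(1)] P5(1)]]) simp
  ultimately show ?case by blast
qed

locale fft_family = slp_family I K inp L
  for I :: "'i set" and K :: "'i \<Rightarrow> ('a, 'b) ring_scheme" and inp :: "'i \<Rightarrow> 'a list" and L :: nat +
  fixes \<omega> :: "'i \<Rightarrow> 'a" and k :: nat
  assumes fft_field: "i \<in> I \<Longrightarrow> fft_field (K i) (\<omega> i) k"
begin

abbreviation halves :: "'i \<Rightarrow> 'a" where
  "halves i \<equiv> inv\<^bsub>K i\<^esub> (\<one>\<^bsub>K i\<^esub> \<oplus>\<^bsub>K i\<^esub> \<one>\<^bsub>K i\<^esub>)"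

text \<open>The constants that all later phases draw on. They are computed once, so they do not
  enter the cost of a step. Exponents of one half up to \<open>Suc k\<close> suffice to normalise
  inverse transforms of length at most \<open>2 * 2 ^ k\<close>.\<close>

definition ready :: "instr list \<Rightarrow> bool" where
  "ready P \<longleftrightarrow> valid P \<and> (\<forall>j::nat. (\<lambda>i. \<omega> i [^]\<^bsub>K i\<^esub> j) \<in> vals P) \<and>
     (\<lambda>i. \<zero>\<^bsub>K i\<^esub>) \<in> vals P \<and> (\<forall>j\<le>Suc k. (\<lambda>i. halves i [^]\<^bsub>K i\<^esub> j) \<in> vals P)"

lemma ready_root: "ready P \<Longrightarrow> (\<lambda>i. \<omega> i [^]\<^bsub>K i\<^esub> (j::nat)) \<in> vals P"
  by (simp add: ready_def)

lemma ready_half: "ready P \<Longrightarrow> j \<le> Suc k \<Longrightarrow> (\<lambda>i. halves i [^]\<^bsub>K i\<^esub> j) \<in> vals P"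
  by (simp add: ready_def)

lemma ready_mono: "ready P \<Longrightarrow> ext c P P' \<Longrightarrow> ready P'"
  unfolding ready_def by (meson ext_validD vals_mono)

text \<open>Finitely many computed values cover all exponents of the root. Index arithmetic such as
  \<open>y + 2 ^ k\<close> can then be done without reduction modulo the length.\<close>

lemma vals_periodic:
  assumes "\<And>y. y < 2 * 2 ^ k \<Longrightarrow> (\<lambda>i. g i (\<omega> i [^]\<^bsub>K i\<^esub> (y::nat))) \<in> vals P"
  shows "(\<lambda>i. g i (\<omega> i [^]\<^bsub>K i\<^esub> (y::nat))) \<in> vals P"
proof (rule vals_cong)
  show "(\<lambda>i. g i (\<omega> i [^]\<^bsub>K i\<^esub> (y mod (2 * 2 ^ k)))) \<in> vals P" by (rule assms) simp
  fix i assume "i \<in> I"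
  then show "g i (\<omega> i [^]\<^bsub>K i\<^esub> y) = g i (\<omega> i [^]\<^bsub>K i\<^esub> (y mod (2 * 2 ^ k)))"
    by (simp add: fft_field.root_mod[OF fft_field])
qed

text \<open>A direct transform with the inverse root recovers the coefficients up to the factor
  \<open>2 ^ m\<close>; the \<open>2 ^ m\<close> extra operations remove it. The exponent
  \<open>e\<close> makes \<open>\<omega> [^] e\<close> a root of order \<open>2 ^ m\<close>: it is
  \<open>1\<close> for the full length and \<open>2\<close> for half of it. The inverse root is
  again a power of \<open>\<omega>\<close>, so no new table is needed.\<close>

lemma ext_inverse_fft:
  fixes e :: nat
  assumes P: "ready P" and f: "\<And>i. i \<in> I \<Longrightarrow> f i \<in> UNIV \<rightarrow> carrier (K i)"
    and m: "2 ^ m * e = 2 * 2 ^ k" "m \<le> Suc k"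
    and F: "\<And>y::nat. y < 2 ^ m \<Longrightarrow>
      (\<lambda>i. evalp (K i) (f i) (2 ^ m) ((\<omega> i [^]\<^bsub>K i\<^esub> e) [^]\<^bsub>K i\<^esub> y)) \<in> vals P"
  shows "\<exists>P'. ext (fft_ops m + 2 ^ m) P P' \<and> (\<forall>j<2 ^ m. (\<lambda>i. f i j) \<in> vals P')"
proof -
  define n where "n = (2::nat) * 2 ^ k"
  define z where "z i = \<omega> i [^]\<^bsub>K i\<^esub> e" for i
  define w where "w i = \<omega> i [^]\<^bsub>K i\<^esub> (e * (n - 1))" for i
  define g where "g i y = evalp (K i) (f i) (2 ^ m) (z i [^]\<^bsub>K i\<^esub> y)" for i and y :: nat
  have inst: "g i \<in> UNIV \<rightarrow> carrier (K i)" "w i \<in> carrier (K i)"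
    "0 < m \<Longrightarrow> w i [^]\<^bsub>K i\<^esub> ((2::nat) ^ (m - 1)) = \<ominus>\<^bsub>K i\<^esub> \<one>\<^bsub>K i\<^esub>"
    "w i [^]\<^bsub>K i\<^esub> j = \<omega> i [^]\<^bsub>K i\<^esub> (e * (n - 1) * j)"
    "j < 2 ^ m \<Longrightarrow> f i j = halves i [^]\<^bsub>K i\<^esub> m \<otimes>\<^bsub>K i\<^esub> evalp (K i) (g i) (2 ^ m) (w i [^]\<^bsub>K i\<^esub> j)"
    if i: "i \<in> I" for i and j :: nat
  proof -
    interpret fft_field "K i" "\<omega> i" k using fft_field[OF i] .
    note fi = f[OF i] and rc = root_closed
    show "g i \<in> UNIV \<rightarrow> carrier (K i)" "w i \<in> carrier (K i)"
      using fi rc by (auto simp: g_def z_def w_def)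
    show wp: "w i [^]\<^bsub>K i\<^esub> j = \<omega> i [^]\<^bsub>K i\<^esub> (e * (n - 1) * j)" for j :: nat
      using rc by (simp add: w_def nat_pow_pow)
    show "w i [^]\<^bsub>K i\<^esub> ((2::nat) ^ (m - 1)) = \<ominus>\<^bsub>K i\<^esub> \<one>\<^bsub>K i\<^esub>" if "0 < m"
    proof -
      have "2 * (2 ^ (m - 1) * e) = 2 * 2 ^ k" using m(1) that by (cases m) auto
      then have e: "2 ^ (m - 1) * e = 2 ^ k" by linarith
      have "e * (n - 1) * 2 ^ (m - 1) = 2 ^ k * (n - 1)"
        by (metis e mult.assoc mult.commute)
      then have "w i [^]\<^bsub>K i\<^esub> ((2::nat) ^ (m - 1)) = (\<ominus>\<^bsub>K i\<^esub> \<one>\<^bsub>K i\<^esub>) [^]\<^bsub>K i\<^esub> (n - 1)"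
        unfolding wp using rc by (simp only: nat_pow_pow[symmetric] root_half)
      moreover have "odd (n - 1)" by (simp add: n_def)
      ultimately show ?thesis by (simp add: pow_uminus)
    qed
    show "f i j = halves i [^]\<^bsub>K i\<^esub> m \<otimes>\<^bsub>K i\<^esub> evalp (K i) (g i) (2 ^ m) (w i [^]\<^bsub>K i\<^esub> j)" if "j < 2 ^ m"
    proof -
      have e: "0 < e" using m(1) by (cases e) auto
      have "e + e * (n - 1) = n * e" by (cases n) (auto simp: n_def)
      then have zw: "z i \<otimes>\<^bsub>K i\<^esub> w i = \<one>\<^bsub>K i\<^esub>"
        unfolding z_def w_def n_def using rc
        by (simp only: nat_pow_mult) (simp add: nat_pow_pow[symmetric] root_pow del: nat_pow_pow)
      have zh: "z i [^]\<^bsub>K i\<^esub> ((2::nat) ^ m) = \<one>\<^bsub>K i\<^esub>"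
        unfolding z_def using rc m(1) by (simp add: nat_pow_pow mult.commute root_pow)
      have zj: "z i [^]\<^bsub>K i\<^esub> l \<noteq> \<one>\<^bsub>K i\<^esub>" if "0 < l" "l < 2 ^ m" for l :: nat
      proof -
        have "e * l < 2 ^ m * e" using that e by (simp add: mult.commute)
        then show ?thesis
          unfolding z_def using rc root_primitive[of "e * l"] e that m(1) by (simp add: nat_pow_pow)
      qed
      have "evalp (K i) (g i) (2 ^ m) (w i [^]\<^bsub>K i\<^esub> j) =
        (\<one>\<^bsub>K i\<^esub> \<oplus>\<^bsub>K i\<^esub> \<one>\<^bsub>K i\<^esub>) [^]\<^bsub>K i\<^esub> m \<otimes>\<^bsub>K i\<^esub> f i j"
        unfolding g_def[abs_def]
        using evalp_inverse_DFT[OF fi _ _ zw zh zj \<open>j < 2 ^ m\<close>] rc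
        by (simp add: finsum_ones_pow2 z_def w_def)
      moreover have "(\<one>\<^bsub>K i\<^esub> \<oplus>\<^bsub>K i\<^esub> \<one>\<^bsub>K i\<^esub>) [^]\<^bsub>K i\<^esub> m \<in> carrier (K i)" "f i j \<in> carrier (K i)"
        using fi by auto
      ultimately have "halves i [^]\<^bsub>K i\<^esub> m \<otimes>\<^bsub>K i\<^esub> evalp (K i) (g i) (2 ^ m) (w i [^]\<^bsub>K i\<^esub> j) =
        ((\<one>\<^bsub>K i\<^esub> \<oplus>\<^bsub>K i\<^esub> \<one>\<^bsub>K i\<^esub>) [^]\<^bsub>K i\<^esub> m \<otimes>\<^bsub>K i\<^esub> halves i [^]\<^bsub>K i\<^esub> m) \<otimes>\<^bsub>K i\<^esub> f i j"
        using nat_pow_closed[OF half_closed, of m] by (metis m_assoc m_comm)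
      then show ?thesis using fi by (auto simp: half_pow Pi_def)
    qed
  qed
  have wv: "(\<lambda>i. w i [^]\<^bsub>K i\<^esub> j) \<in> vals P" for j :: nat
    by (rule vals_cong[of "\<lambda>i. \<omega> i [^]\<^bsub>K i\<^esub> (e * (n - 1) * j)"]) (use P in \<open>auto simp: ready_def inst(4)\<close>)
  have "\<exists>P'. ext (fft_ops m) P P' \<and> (\<forall>y<2 ^ m. (\<lambda>i. evalp (K i) (g i) (2 ^ m) (w i [^]\<^bsub>K i\<^esub> (y::nat))) \<in> vals P')"
  proof (rule ext_fft)
    show "valid P" using P by (simp add: ready_def)
  qed (use inst(1-3) wv F in \<open>auto simp: g_def z_def\<close>)
  then obtain P1 where P1: "ext (fft_ops m) P P1"
    "\<And>y::nat. y < 2 ^ m \<Longrightarrow> (\<lambda>i. evalp (K i) (g i) (2 ^ m) (w i [^]\<^bsub>K i\<^esub> y)) \<in> vals P1" by auto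
  have "(\<lambda>i. halves i [^]\<^bsub>K i\<^esub> m) \<in> vals P1" using ready_mono[OF P P1(1)] m(2) by (auto simp: ready_def)
  then have "opval P1 (\<lambda>i. f i j)" if "j < 2 ^ m" for j
    by (rule opval_mult[OF _ P1(2)[OF that]]) (rule inst(5)[OF _ that])
  from ext_opvals[of P1 "2 ^ m" "\<lambda>j i. f i j", OF ext_validD[OF P1(1)] this]
  show ?thesis using ext_trans[OF P1(1)] by blast
qed

text \<open>
  The saving of Bostan and Mori: the even-indexed values of a polynomial of degree below \<open>2 ^ k\<close> are
  already there, and the odd-indexed ones are the transform of the twisted coefficients
  \<open>\<omega> ^ m * f m\<close>. Two transforms of half length suffice.
\<close>

lemma ext_double:
  assumes P: "ready P" and f: "\<And>i. i \<in> I \<Longrightarrow> f i \<in> UNIV \<rightarrow> carrier (K i)"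
    and supp: "\<And>i m. i \<in> I \<Longrightarrow> 2 ^ k \<le> m \<Longrightarrow> f i m = \<zero>\<^bsub>K i\<^esub>"
    and F: "\<And>y::nat. y < 2 ^ k \<Longrightarrow>
      (\<lambda>i. evalp (K i) (f i) (2 ^ k) (\<omega> i [^]\<^bsub>K i\<^esub> y \<otimes>\<^bsub>K i\<^esub> \<omega> i [^]\<^bsub>K i\<^esub> y)) \<in> vals P"
  shows "\<exists>P'. ext (2 * fft_ops k + 2 * 2 ^ k) P P' \<and>
    (\<forall>y::nat. (\<lambda>i. evalp (K i) (f i) (2 * 2 ^ k) (\<omega> i [^]\<^bsub>K i\<^esub> y)) \<in> vals P')"
proof -
  define z where "z i = \<omega> i [^]\<^bsub>K i\<^esub> (2::nat)" for i
  define g where "g i m = \<omega> i [^]\<^bsub>K i\<^esub> m \<otimes>\<^bsub>K i\<^esub> f i m" for i and m :: nat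
  have inst: "z i \<in> carrier (K i)" "z i [^]\<^bsub>K i\<^esub> y = \<omega> i [^]\<^bsub>K i\<^esub> (2 * y)"
    "g i \<in> UNIV \<rightarrow> carrier (K i)"
    "0 < k \<Longrightarrow> z i [^]\<^bsub>K i\<^esub> ((2::nat) ^ (k - 1)) = \<ominus>\<^bsub>K i\<^esub> \<one>\<^bsub>K i\<^esub>"
    "\<omega> i [^]\<^bsub>K i\<^esub> y \<otimes>\<^bsub>K i\<^esub> \<omega> i [^]\<^bsub>K i\<^esub> y = z i [^]\<^bsub>K i\<^esub> y"
    "evalp (K i) (f i) (2 * 2 ^ k) (\<omega> i [^]\<^bsub>K i\<^esub> (2 * y)) = evalp (K i) (f i) (2 ^ k) (z i [^]\<^bsub>K i\<^esub> y)"
    "evalp (K i) (f i) (2 * 2 ^ k) (\<omega> i [^]\<^bsub>K i\<^esub> (2 * y + 1)) = evalp (K i) (g i) (2 ^ k) (z i [^]\<^bsub>K i\<^esub> y)"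
    if i: "i \<in> I" for i and y :: nat
  proof -
    interpret fft_field "K i" "\<omega> i" k using fft_field[OF i] .
    note fi = f[OF i] and rc = root_closed
    show zc: "z i \<in> carrier (K i)" using rc by (simp add: z_def)
    show zp: "z i [^]\<^bsub>K i\<^esub> y = \<omega> i [^]\<^bsub>K i\<^esub> (2 * y)" for y :: nat
      using rc by (simp add: z_def nat_pow_pow)
    show gi: "g i \<in> UNIV \<rightarrow> carrier (K i)" using rc fi by (auto simp: g_def Pi_def)
    show "z i [^]\<^bsub>K i\<^esub> ((2::nat) ^ (k - 1)) = \<ominus>\<^bsub>K i\<^esub> \<one>\<^bsub>K i\<^esub>" if "0 < k"
    proof -
      have "2 * 2 ^ (k - 1) = (2::nat) ^ k" using that by (cases k) auto
      then show ?thesis unfolding zp by (simp only: root_half)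
    qed
    show "\<omega> i [^]\<^bsub>K i\<^esub> y \<otimes>\<^bsub>K i\<^esub> \<omega> i [^]\<^bsub>K i\<^esub> y = z i [^]\<^bsub>K i\<^esub> y"
      using rc by (simp add: zp nat_pow_mult mult_2)
    have short: "evalp (K i) (f i) (2 * 2 ^ k) x = evalp (K i) (f i) (2 ^ k) x" if "x \<in> carrier (K i)" for x
      using that fi supp[OF i] by (intro evalp_extend) auto
    show "evalp (K i) (f i) (2 * 2 ^ k) (\<omega> i [^]\<^bsub>K i\<^esub> (2 * y)) = evalp (K i) (f i) (2 ^ k) (z i [^]\<^bsub>K i\<^esub> y)"
      unfolding zp by (rule short) (use rc in simp)
    have "evalp (K i) (f i) (2 ^ k) (\<omega> i [^]\<^bsub>K i\<^esub> (2 * y + 1)) = evalp (K i) (g i) (2 ^ k) (z i [^]\<^bsub>K i\<^esub> y)"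
      unfolding evalp_def
    proof (intro finsum_cong')
      fix j :: nat
      have "(\<omega> i [^]\<^bsub>K i\<^esub> (2 * y + 1)) [^]\<^bsub>K i\<^esub> j = \<omega> i [^]\<^bsub>K i\<^esub> j \<otimes>\<^bsub>K i\<^esub> (z i [^]\<^bsub>K i\<^esub> y) [^]\<^bsub>K i\<^esub> j"
        unfolding zp using rc by (simp only: nat_pow_pow nat_pow_mult) (simp add: algebra_simps)
      then show "f i j \<otimes>\<^bsub>K i\<^esub> (\<omega> i [^]\<^bsub>K i\<^esub> (2 * y + 1)) [^]\<^bsub>K i\<^esub> j = g i j \<otimes>\<^bsub>K i\<^esub> (z i [^]\<^bsub>K i\<^esub> y) [^]\<^bsub>K i\<^esub> j"
        using rc fi zc by (simp add: g_def m_ac Pi_def)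
    qed (use gi zc in auto)
    then show "evalp (K i) (f i) (2 * 2 ^ k) (\<omega> i [^]\<^bsub>K i\<^esub> (2 * y + 1)) = evalp (K i) (g i) (2 ^ k) (z i [^]\<^bsub>K i\<^esub> y)"
      using short[of "\<omega> i [^]\<^bsub>K i\<^esub> (2 * y + 1)"] rc by simp
  qed
  have F': "(\<lambda>i. evalp (K i) (f i) (2 ^ k) (z i [^]\<^bsub>K i\<^esub> y)) \<in> vals P" if "y < 2 ^ k" for y :: nat
    by (rule vals_cong[OF F[OF that]]) (simp add: inst)
  have "\<exists>P'. ext (fft_ops k + 2 ^ k) P P' \<and> (\<forall>j<2 ^ k. (\<lambda>i. f i j) \<in> vals P')"
    using F' by (intro ext_inverse_fft[OF P f, where e = 2]) (auto simp: z_def)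
  then obtain P1 where P1: "ext (fft_ops k + 2 ^ k) P P1" "\<And>j. j < 2 ^ k \<Longrightarrow> (\<lambda>i. f i j) \<in> vals P1" by auto
  note ready1 = ready_mono[OF P P1(1)]
  have "opval P1 (\<lambda>i. g i j)" if "j < 2 ^ k" for j
    using ready1 P1(2)[OF that] by (intro opval_mult[of "\<lambda>i. \<omega> i [^]\<^bsub>K i\<^esub> j" _ "\<lambda>i. f i j"]) (auto simp: ready_def g_def)
  from ext_opvals[of P1 "2 ^ k" "\<lambda>j i. g i j", OF ext_validD[OF P1(1)] this]
  obtain P2 where P2: "ext (2 ^ k) P1 P2" "\<And>j. j < 2 ^ k \<Longrightarrow> (\<lambda>i. g i j) \<in> vals P2" by blast
  note ready2 = ready_mono[OF ready1 P2(1)]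
  have zv: "(\<lambda>i. z i [^]\<^bsub>K i\<^esub> j) \<in> vals P2" for j :: nat
    by (rule vals_cong[of "\<lambda>i. \<omega> i [^]\<^bsub>K i\<^esub> (2 * j)"]) (use ready2 in \<open>auto simp: ready_def inst(2)\<close>)
  have "\<exists>P'. ext (fft_ops k) P2 P' \<and> (\<forall>y<2 ^ k. (\<lambda>i. evalp (K i) (g i) (2 ^ k) (z i [^]\<^bsub>K i\<^esub> (y::nat))) \<in> vals P')"
    by (rule ext_fft) (use inst(1,3,4) zv P2(2) ext_validD[OF P2(1)] in auto)
  then obtain P3 where P3: "ext (fft_ops k) P2 P3"
    "\<And>y::nat. y < 2 ^ k \<Longrightarrow> (\<lambda>i. evalp (K i) (g i) (2 ^ k) (z i [^]\<^bsub>K i\<^esub> y)) \<in> vals P3" by auto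
  have "(\<lambda>i. evalp (K i) (f i) (2 * 2 ^ k) (\<omega> i [^]\<^bsub>K i\<^esub> y)) \<in> vals P3" if y: "y < 2 * 2 ^ k" for y :: nat
  proof (cases "even y")
    case True
    then obtain x where x: "y = 2 * x" by auto
    then have "(\<lambda>i. evalp (K i) (f i) (2 ^ k) (z i [^]\<^bsub>K i\<^esub> x)) \<in> vals P3"
      using vals_mono[OF P3(1) vals_mono[OF P2(1) vals_mono[OF P1(1) F'[of x]]]] y by auto
    then show ?thesis by (rule vals_cong) (simp add: x inst(6))
  next
    case False
    then obtain x where x: "y = 2 * x + 1" by (elim oddE)
    then have "(\<lambda>i. evalp (K i) (g i) (2 ^ k) (z i [^]\<^bsub>K i\<^esub> x)) \<in> vals P3" using P3(2)[of x] y by auto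
    then show ?thesis by (rule vals_cong) (simp only: x inst(7))
  qed
  then have "\<forall>y::nat. (\<lambda>i. evalp (K i) (f i) (2 * 2 ^ k) (\<omega> i [^]\<^bsub>K i\<^esub> y)) \<in> vals P3"
    using vals_periodic[of "\<lambda>i. evalp (K i) (f i) (2 * 2 ^ k)"] by blast
  moreover have "ext (2 * fft_ops k + 2 * 2 ^ k) P P3"
    by (rule ext_le[OF ext_trans[OF ext_trans[OF P1(1) P2(1)] P3(1)]]) simp
  ultimately show ?thesis by blast
qed


lemma ext_full_fft:
  assumes P: "ready P" and f: "\<And>i. i \<in> I \<Longrightarrow> f i \<in> UNIV \<rightarrow> carrier (K i)"
    and v: "\<And>j. j < 2 * 2 ^ k \<Longrightarrow> (\<lambda>i. f i j) \<in> vals P"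
  shows "\<exists>P'. ext (fft_ops (Suc k)) P P' \<and>
    (\<forall>y::nat. (\<lambda>i. evalp (K i) (f i) (2 * 2 ^ k) (\<omega> i [^]\<^bsub>K i\<^esub> y)) \<in> vals P')"
proof -
  have "\<exists>P'. ext (fft_ops (Suc k)) P P' \<and>
    (\<forall>y<2 ^ Suc k. (\<lambda>i. evalp (K i) (f i) (2 ^ Suc k) (\<omega> i [^]\<^bsub>K i\<^esub> (y::nat))) \<in> vals P')"
  proof (rule ext_fft[OF _ f])
    fix i assume "i \<in> I"
    then interpret fft_field "K i" "\<omega> i" k using fft_field by blast
    show "\<omega> i \<in> carrier (K i)" by (rule root_closed)
    show "\<omega> i [^]\<^bsub>K i\<^esub> ((2::nat) ^ (Suc k - 1)) = \<ominus>\<^bsub>K i\<^esub> \<one>\<^bsub>K i\<^esub>" using root_half by simp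
  qed (use P v in \<open>auto simp: ready_def\<close>)
  then obtain P' where P': "ext (fft_ops (Suc k)) P P'"
    "\<And>y::nat. y < 2 * 2 ^ k \<Longrightarrow> (\<lambda>i. evalp (K i) (f i) (2 * 2 ^ k) (\<omega> i [^]\<^bsub>K i\<^esub> y)) \<in> vals P'"
    by (auto simp: power_Suc)
  then show ?thesis using vals_periodic[of "\<lambda>i. evalp (K i) (f i) (2 * 2 ^ k)" P'] by blast
qed

lemma ext_full_inverse_fft:
  assumes P: "ready P" and f: "\<And>i. i \<in> I \<Longrightarrow> f i \<in> UNIV \<rightarrow> carrier (K i)"
    and F: "\<And>y::nat. (\<lambda>i. evalp (K i) (f i) (2 * 2 ^ k) (\<omega> i [^]\<^bsub>K i\<^esub> y)) \<in> vals P"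
  shows "\<exists>P'. ext (fft_ops (Suc k) + 2 * 2 ^ k) P P' \<and> (\<forall>j<2 * 2 ^ k. (\<lambda>i. f i j) \<in> vals P')"
proof -
  have "\<exists>P'. ext (fft_ops (Suc k) + 2 ^ Suc k) P P' \<and> (\<forall>j<2 ^ Suc k. (\<lambda>i. f i j) \<in> vals P')"
  proof (rule ext_inverse_fft[OF P f, where e = 1])
    fix y :: nat
    show "(\<lambda>i. evalp (K i) (f i) (2 ^ Suc k) ((\<omega> i [^]\<^bsub>K i\<^esub> (1::nat)) [^]\<^bsub>K i\<^esub> y)) \<in> vals P"
    proof (rule vals_cong[OF F[of y]])
      fix i assume "i \<in> I"
      then interpret fft_field "K i" "\<omega> i" k using fft_field by blast
      show "evalp (K i) (f i) (2 ^ Suc k) ((\<omega> i [^]\<^bsub>K i\<^esub> (1::nat)) [^]\<^bsub>K i\<^esub> y) =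
        evalp (K i) (f i) (2 * 2 ^ k) (\<omega> i [^]\<^bsub>K i\<^esub> y)" using root_closed by simp
    qed
  qed auto
  then show ?thesis by simp
qed

text \<open>
  The sequence \<open>w\<close> has generating function \<open>p(x) / q(x)\<close>, and \<open>P\<close> holds the transforms of \<open>p\<close> and \<open>q\<close>.
\<close>

definition represents :: "nat \<Rightarrow> instr list \<Rightarrow> ('i \<Rightarrow> nat \<Rightarrow> 'a) \<Rightarrow> ('i \<Rightarrow> nat \<Rightarrow> 'a) \<Rightarrow> ('i \<Rightarrow> nat \<Rightarrow> 'a) \<Rightarrow> bool" where
  "represents d P p q w \<longleftrightarrow>
     (\<forall>i\<in>I. p i \<in> UNIV \<rightarrow> carrier (K i) \<and> q i \<in> UNIV \<rightarrow> carrier (K i) \<and> w i \<in> UNIV \<rightarrow> carrier (K i) \<and>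
        (\<forall>m\<ge>d. p i m = \<zero>\<^bsub>K i\<^esub>) \<and> (\<forall>m>d. q i m = \<zero>\<^bsub>K i\<^esub>) \<and> q i 0 = \<one>\<^bsub>K i\<^esub> \<and> conv (K i) (q i) (w i) = p i) \<and>
     (\<forall>y::nat. (\<lambda>i. evalp (K i) (p i) (2 * 2 ^ k) (\<omega> i [^]\<^bsub>K i\<^esub> y)) \<in> vals P) \<and>
     (\<forall>y::nat. (\<lambda>i. evalp (K i) (q i) (2 * 2 ^ k) (\<omega> i [^]\<^bsub>K i\<^esub> y)) \<in> vals P)"

text \<open>The linear part \<open>10 * 2 ^ k\<close> consists of \<open>2 ^ k\<close> products for
  \<open>v\<close>, twice as many for \<open>u\<close>, \<open>2 ^ k\<close> operations each for
  \<open>s\<close>, \<open>s'\<close> and \<open>x\<close>, and \<open>2 * 2 ^ k\<close> in each of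
  the two calls of \<open>ext_double\<close>. The transforms come from these two calls
  alone.\<close>

lemma ext_step:
  assumes P: "ready P" and R: "represents d P p q w" and d: "1 \<le> d" "d < 2 ^ k" and b: "b < 2"
  shows "\<exists>P' p' q'. ext (4 * fft_ops k + 10 * 2 ^ k) P P' \<and> represents d P' p' q' (\<lambda>i m. w i (2 * m + b))"
proof -
  define V where "V i = conv (K i) (alt (K i) (q i)) (q i)" for i
  define U where "U i = conv (K i) (alt (K i) (q i)) (p i)" for i
  define q' where "q' i m = V i (2 * m)" for i m
  define p' where "p' i m = U i (2 * m + b)" for i m
  define A where "A y i = evalp (K i) (p i) (2 * 2 ^ k) (\<omega> i [^]\<^bsub>K i\<^esub> y)" for y :: nat and i
  define B where "B y i = evalp (K i) (q i) (2 * 2 ^ k) (\<omega> i [^]\<^bsub>K i\<^esub> y)" for y :: nat and i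
  define u where "u y i = evalp (K i) (U i) (2 * 2 ^ k) (\<omega> i [^]\<^bsub>K i\<^esub> y)" for y :: nat and i
  define v where "v y i = evalp (K i) (q' i) (2 ^ k) (\<omega> i [^]\<^bsub>K i\<^esub> y \<otimes>\<^bsub>K i\<^esub> \<omega> i [^]\<^bsub>K i\<^esub> y)" for y :: nat and i
  define x where "x y i = evalp (K i) (p' i) (2 ^ k) (\<omega> i [^]\<^bsub>K i\<^esub> y \<otimes>\<^bsub>K i\<^esub> \<omega> i [^]\<^bsub>K i\<^esub> y)" for y :: nat and i
  define s where "s y i = (if b = 0 then u y i \<oplus>\<^bsub>K i\<^esub> u (y + 2 ^ k) i else u y i \<ominus>\<^bsub>K i\<^esub> u (y + 2 ^ k) i)" for y i
  define s' where "s' y i = halves i \<otimes>\<^bsub>K i\<^esub> s y i" for y i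
  have inst:
    "p' i \<in> UNIV \<rightarrow> carrier (K i)" "q' i \<in> UNIV \<rightarrow> carrier (K i)"
    "d \<le> m \<Longrightarrow> p' i m = \<zero>\<^bsub>K i\<^esub>" "d < m \<Longrightarrow> q' i m = \<zero>\<^bsub>K i\<^esub>"
    "q' i 0 = \<one>\<^bsub>K i\<^esub>" "conv (K i) (q' i) (\<lambda>m. w i (2 * m + b)) = p' i"
    "u y i = B (y + 2 ^ k) i \<otimes>\<^bsub>K i\<^esub> A y i" "v y i = B (y + 2 ^ k) i \<otimes>\<^bsub>K i\<^esub> B y i"
    "y < 2 * 2 ^ k \<Longrightarrow> x y i = (if b = 0 then s' y i else \<omega> i [^]\<^bsub>K i\<^esub> (2 * 2 ^ k - y) \<otimes>\<^bsub>K i\<^esub> s' y i)"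
    "(\<lambda>m. w i (2 * m + b)) \<in> UNIV \<rightarrow> carrier (K i)"
    if i: "i \<in> I" for i m y
  proof -
    interpret fft_field "K i" "\<omega> i" k using fft_field[OF i] .
    have pi: "p i \<in> UNIV \<rightarrow> carrier (K i)" and qi: "q i \<in> UNIV \<rightarrow> carrier (K i)"
      and wi: "w i \<in> UNIV \<rightarrow> carrier (K i)"
      and ps: "\<And>m. d \<le> m \<Longrightarrow> p i m = \<zero>\<^bsub>K i\<^esub>" and qs: "\<And>m. d < m \<Longrightarrow> q i m = \<zero>\<^bsub>K i\<^esub>"
      and q0: "q i 0 = \<one>\<^bsub>K i\<^esub>" and c: "conv (K i) (q i) (w i) = p i"
      using R i by (auto simp: represents_def)
    note hyps = pi qi wi ps qs q0 c b d
    show "p' i \<in> UNIV \<rightarrow> carrier (K i)" "q' i \<in> UNIV \<rightarrow> carrier (K i)"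
      using step_closed[OF hyps] by (auto simp: p'_def q'_def U_def V_def)
    show "d \<le> m \<Longrightarrow> p' i m = \<zero>\<^bsub>K i\<^esub>" "d < m \<Longrightarrow> q' i m = \<zero>\<^bsub>K i\<^esub>"
      using step_supp[OF hyps] by (auto simp: p'_def q'_def U_def V_def)
    show "q' i 0 = \<one>\<^bsub>K i\<^esub>" using step_0[OF hyps] by (simp add: q'_def V_def)
    show "conv (K i) (q' i) (\<lambda>m. w i (2 * m + b)) = p' i"
      using step_conv[OF hyps] by (simp add: p'_def[abs_def] q'_def[abs_def] U_def V_def)
    show "u y i = B (y + 2 ^ k) i \<otimes>\<^bsub>K i\<^esub> A y i"
      using evalp_step_numer[OF hyps, of y] by (simp add: u_def A_def B_def U_def)
    show "v y i = B (y + 2 ^ k) i \<otimes>\<^bsub>K i\<^esub> B y i"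
      using evalp_step_denom[OF hyps, of y] by (simp add: v_def B_def q'_def[abs_def] V_def)
    show "x y i = (if b = 0 then s' y i else \<omega> i [^]\<^bsub>K i\<^esub> (2 * 2 ^ k - y) \<otimes>\<^bsub>K i\<^esub> s' y i)" if "y < 2 * 2 ^ k"
      using evalp_step_numer_part[OF hyps that]
      by (simp add: x_def p'_def[abs_def] s'_def s_def u_def U_def)
    show "(\<lambda>m. w i (2 * m + b)) \<in> UNIV \<rightarrow> carrier (K i)" using wi by auto
  qed
  have AB: "A y \<in> vals P" "B y \<in> vals P" for y
    using R by (auto simp: represents_def A_def[abs_def] B_def[abs_def])
  have ops: "opval P (v y)" "opval P (u y)" for y
    by (rule opval_mult[OF AB(2) AB(2) inst(8)], assumption) (rule opval_mult[OF AB(2) AB(1) inst(7)])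
  \<comment> \<open>The new denominator comes from an even polynomial, so half of the values
    suffice. The part of parity \<open>b\<close> of the numerator combines the values at
    \<open>y\<close> and \<open>y + 2 ^ k\<close>, which requires all of them.\<close>
  obtain P1 where P1: "ext (2 ^ k) P P1" "\<And>y. y < 2 ^ k \<Longrightarrow> v y \<in> vals P1"
    using ext_opvals[of P "2 ^ k" v] ops P by (auto simp: ready_def)
  obtain P2 where P2: "ext (2 * 2 ^ k) P1 P2" "\<And>y. y < 2 * 2 ^ k \<Longrightarrow> u y \<in> vals P2"
    using ext_opvals[of P1 "2 * 2 ^ k" u] opval_mono[OF P1(1) ops(2)] ext_validD[OF P1(1)] by auto
  have "opval P2 (s y)" if "y < 2 ^ k" for y
  proof (cases "b = 0")
    case True
    then show ?thesis using P2(2) that by (intro opval_add[of "u y" _ "u (y + 2 ^ k)"]) (auto simp: s_def)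
  next
    case False
    then show ?thesis using P2(2) that by (intro opval_sub[of "u y" _ "u (y + 2 ^ k)"]) (auto simp: s_def)
  qed
  then obtain P3 where P3: "ext (2 ^ k) P2 P3" "\<And>y. y < 2 ^ k \<Longrightarrow> s y \<in> vals P3"
    using ext_opvals[of P2 "2 ^ k" s] ext_validD[OF P2(1)] by auto
  note ready3 = ready_mono[OF ready_mono[OF ready_mono[OF P P1(1)] P2(1)] P3(1)]
  have "halves \<in> vals P3"
  proof (rule vals_cong)
    show "(\<lambda>i. halves i [^]\<^bsub>K i\<^esub> (1::nat)) \<in> vals P3" by (rule ready_half[OF ready3]) simp
    fix i assume "i \<in> I"
    then interpret fft_field "K i" "\<omega> i" k using fft_field by blast
    show "halves i = halves i [^]\<^bsub>K i\<^esub> (1::nat)" using nat_pow_eone[OF half_closed] by (rule sym)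
  qed
  then have "opval P3 (s' y)" if "y < 2 ^ k" for y
    using P3(2)[OF that] by (intro opval_mult[of halves _ "s y"]) (auto simp: s'_def)
  then obtain P4 where P4: "ext (2 ^ k) P3 P4" "\<And>y. y < 2 ^ k \<Longrightarrow> s' y \<in> vals P4"
    using ext_opvals[of P3 "2 ^ k" s'] ext_validD[OF P3(1)] by auto
  note ready4 = ready_mono[OF ready3 P4(1)]
  have "\<exists>P5. ext (2 ^ k) P4 P5 \<and> (\<forall>y<2 ^ k. x y \<in> vals P5)"
  proof (cases "b = 0")
    case True
    have "x y \<in> vals P4" if "y < 2 ^ k" for y
      by (rule vals_cong[OF P4(2)[OF that]]) (use that True inst(9)[of _ y] in auto)
    \<comment> \<open>The even part needs no division by a power of the root. The operations of the
      odd case are charged nevertheless, so that the bound for a step does not depend on the digit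
      \<open>b\<close>.\<close>
    then show ?thesis using ext_le[OF ext_refl[OF ext_validD[OF P4(1)]]] by blast
  next
    case False
    have "opval P4 (x y)" if "y < 2 ^ k" for y
    proof (rule opval_mult)
      show "(\<lambda>i. \<omega> i [^]\<^bsub>K i\<^esub> (2 * 2 ^ k - y)) \<in> vals P4" using ready4 by (simp add: ready_def)
      show "s' y \<in> vals P4" using P4(2)[OF that] .
    qed (use that False inst(9)[of _ y] in auto)
    then show ?thesis using ext_opvals[of P4 "2 ^ k" x] ext_validD[OF P4(1)] by auto
  qed
  then obtain P5 where P5: "ext (2 ^ k) P4 P5" "\<And>y. y < 2 ^ k \<Longrightarrow> x y \<in> vals P5" by auto
  note ready5 = ready_mono[OF ready4 P5(1)]
  have v5: "v y \<in> vals P5" if "y < 2 ^ k" for y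
    using vals_mono[OF P5(1) vals_mono[OF P4(1) vals_mono[OF P3(1) vals_mono[OF P2(1) P1(2)[OF that]]]]] .
  have "\<exists>P'. ext (2 * fft_ops k + 2 * 2 ^ k) P5 P' \<and>
    (\<forall>y::nat. (\<lambda>i. evalp (K i) (p' i) (2 * 2 ^ k) (\<omega> i [^]\<^bsub>K i\<^esub> y)) \<in> vals P')"
    by (rule ext_double[OF ready5]) (use inst(1,3) P5(2) d in \<open>auto simp: x_def[abs_def]\<close>)
  then obtain P6 where P6: "ext (2 * fft_ops k + 2 * 2 ^ k) P5 P6"
    "\<And>y::nat. (\<lambda>i. evalp (K i) (p' i) (2 * 2 ^ k) (\<omega> i [^]\<^bsub>K i\<^esub> y)) \<in> vals P6" by auto
  note ready6 = ready_mono[OF ready5 P6(1)]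
  have "\<exists>P'. ext (2 * fft_ops k + 2 * 2 ^ k) P6 P' \<and>
    (\<forall>y::nat. (\<lambda>i. evalp (K i) (q' i) (2 * 2 ^ k) (\<omega> i [^]\<^bsub>K i\<^esub> y)) \<in> vals P')"
    by (rule ext_double[OF ready6]) (use inst(2,4) vals_mono[OF P6(1) v5] d in \<open>auto simp: v_def[abs_def]\<close>)
  then obtain P7 where P7: "ext (2 * fft_ops k + 2 * 2 ^ k) P6 P7"
    "\<And>y::nat. (\<lambda>i. evalp (K i) (q' i) (2 * 2 ^ k) (\<omega> i [^]\<^bsub>K i\<^esub> y)) \<in> vals P7" by auto
  have "represents d P7 p' q' (\<lambda>i m. w i (2 * m + b))"
    unfolding represents_def using inst(1-6,10) vals_mono[OF P7(1) P6(2)] P7(2) by auto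
  moreover have "ext (4 * fft_ops k + 10 * 2 ^ k) P P7"
    by (rule ext_le[OF ext_trans[OF ext_trans[OF ext_trans[OF ext_trans[OF ext_trans[OF ext_trans[OF
      P1(1) P2(1)] P3(1)] P4(1)] P5(1)] P6(1)] P7(1)]]) simp
  ultimately show ?thesis by blast
qed

text \<open>The digits of \<open>N\<close> are consumed from the least significant one, by
  \<open>N = 2 * (N div 2) + N mod 2\<close>. When none is left the index is \<open>0\<close>, and
  the constant coefficients of \<open>q w = p\<close> give \<open>w 0 = p 0\<close> because
  \<open>q 0 = 1\<close>. This coefficient is recovered by one inverse transform of full length,
  whose cost does not depend on \<open>t\<close>.\<close>

lemma ext_loop:
  assumes "ready P" "represents d P p q w" "1 \<le> d" "d < 2 ^ k" "N < 2 ^ t"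
  shows "\<exists>P'. ext (t * (4 * fft_ops k + 10 * 2 ^ k) + (fft_ops (Suc k) + 2 * 2 ^ k)) P P' \<and> (\<lambda>i. w i N) \<in> vals P'"
  using assms
proof (induction t arbitrary: P p q w N)
  case 0
  have *: "p i \<in> UNIV \<rightarrow> carrier (K i)" "w i N = p i 0" if i: "i \<in> I" for i
  proof -
    interpret fft_field "K i" "\<omega> i" k using fft_field[OF i] .
    have r: "p i \<in> UNIV \<rightarrow> carrier (K i)" "w i \<in> UNIV \<rightarrow> carrier (K i)" "q i 0 = \<one>\<^bsub>K i\<^esub>"
       "conv (K i) (q i) (w i) = p i"
      using "0.prems"(2) i by (auto simp: represents_def)
    then have "w i 0 \<in> carrier (K i)" by auto
    then have "p i 0 = w i 0" using r(3) by (simp add: r(4)[symmetric] conv_def)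
    then show "p i \<in> UNIV \<rightarrow> carrier (K i)" "w i N = p i 0" using "0.prems"(5) r by auto
  qed
  obtain P' where P': "ext (fft_ops (Suc k) + 2 * 2 ^ k) P P'" "(\<lambda>i. p i 0) \<in> vals P'"
    using ext_full_inverse_fft[OF "0.prems"(1) *(1)] "0.prems"(2) by (force simp: represents_def)
  have "(\<lambda>i. w i N) \<in> vals P'" by (rule vals_cong[OF P'(2)]) (use * in auto)
  then show ?case using P'(1) by auto
next
  case (Suc t)
  obtain P1 p' q' where P1: "ext (4 * fft_ops k + 10 * 2 ^ k) P P1"
    "represents d P1 p' q' (\<lambda>i m. w i (2 * m + N mod 2))"
    using ext_step[OF Suc.prems(1-4), of "N mod 2"] by auto
  have "N div 2 < 2 ^ t" using Suc.prems(5) by auto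
  from Suc.IH[OF ready_mono[OF Suc.prems(1) P1(1)] P1(2) Suc.prems(3,4) this]
  obtain P2 where P2: "ext (t * (4 * fft_ops k + 10 * 2 ^ k) + (fft_ops (Suc k) + 2 * 2 ^ k)) P1 P2"
    "(\<lambda>i. w i N) \<in> vals P2" by auto
  have "Suc t * (4 * fft_ops k + 10 * 2 ^ k) + (fft_ops (Suc k) + 2 * 2 ^ k) =
    (4 * fft_ops k + 10 * 2 ^ k) + (t * (4 * fft_ops k + 10 * 2 ^ k) + (fft_ops (Suc k) + 2 * 2 ^ k))"
    by (simp only: mult_Suc add.assoc)
  then show ?case using ext_trans[OF P1(1) P2(1)] P2(2) by metis
qed


text \<open>The inputs supply \<open>1\<close> and the root; zero, two and one half arise as
  \<open>1 - 1\<close>, \<open>1 + 1\<close> and \<open>1 / (1 + 1)\<close>. The last is the only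
  division in the whole algorithm.\<close>

lemma ext_ready:
  assumes "valid P" and one: "(\<lambda>i. \<one>\<^bsub>K i\<^esub>) \<in> vals P" and "\<omega> \<in> vals P"
  shows "\<exists>P'. ext (2 * 2 ^ k + k + 4) P P' \<and> ready P'"
proof -
  have "\<exists>P'. ext (2 * 2 ^ k) P P' \<and> (\<forall>j\<le>2 * 2 ^ k. (\<lambda>i. \<omega> i [^]\<^bsub>K i\<^esub> (j::nat)) \<in> vals P')"
  proof (rule ext_iterate[OF assms(1) _ assms(3)])
    show "(\<lambda>i. \<omega> i [^]\<^bsub>K i\<^esub> (0::nat)) \<in> vals P" using one by (simp add: nat_pow_def)
  qed (simp add: nat_pow_def)
  then obtain P1 where P1: "ext (2 * 2 ^ k) P P1"
    "\<And>j. j \<le> 2 * 2 ^ k \<Longrightarrow> (\<lambda>i. \<omega> i [^]\<^bsub>K i\<^esub> (j::nat)) \<in> vals P1" by blast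
  have pow1: "(\<lambda>i. \<omega> i [^]\<^bsub>K i\<^esub> (j::nat)) \<in> vals P1" for j
    using vals_periodic[of "\<lambda>i x. x" P1] P1(2) by auto
  note one1 = vals_mono[OF P1(1) one]
  have "opval P1 (\<lambda>i. \<zero>\<^bsub>K i\<^esub>)"
  proof (rule opval_sub[OF one1 one1])
    fix i assume "i \<in> I"
    then interpret field "K i" by (rule field_K)
    show "\<zero>\<^bsub>K i\<^esub> = \<one>\<^bsub>K i\<^esub> \<ominus>\<^bsub>K i\<^esub> \<one>\<^bsub>K i\<^esub>" by (simp add: minus_eq r_neg)
  qed
  then obtain P2 where P2: "ext 1 P1 P2" "(\<lambda>i. \<zero>\<^bsub>K i\<^esub>) \<in> vals P2"
    using ext_opval ext_validD[OF P1(1)] by blast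
  note one2 = vals_mono[OF P2(1) one1]
  have "opval P2 (\<lambda>i. \<one>\<^bsub>K i\<^esub> \<oplus>\<^bsub>K i\<^esub> \<one>\<^bsub>K i\<^esub>)" by (rule opval_add[OF one2 one2]) simp
  then obtain P3 where P3: "ext 1 P2 P3" "(\<lambda>i. \<one>\<^bsub>K i\<^esub> \<oplus>\<^bsub>K i\<^esub> \<one>\<^bsub>K i\<^esub>) \<in> vals P3"
    using ext_opval ext_validD[OF P2(1)] by blast
  have "opval P3 halves"
  proof (rule opval_div[OF vals_mono[OF P3(1) one2] P3(2)])
    fix i assume "i \<in> I"
    then interpret fft_field "K i" "\<omega> i" k using fft_field by blast
    show "\<one>\<^bsub>K i\<^esub> \<oplus>\<^bsub>K i\<^esub> \<one>\<^bsub>K i\<^esub> \<noteq> \<zero>\<^bsub>K i\<^esub> \<and> halves i = \<one>\<^bsub>K i\<^esub> \<otimes>\<^bsub>K i\<^esub> halves i"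
      using two_nonzero l_one[OF half_closed] by simp
  qed
  then obtain P4 where P4: "ext 1 P3 P4" "halves \<in> vals P4"
    using ext_opval ext_validD[OF P3(1)] by blast
  have "\<exists>P'. ext (Suc k) P4 P' \<and> (\<forall>j\<le>Suc k. (\<lambda>i. halves i [^]\<^bsub>K i\<^esub> j) \<in> vals P')"
  proof (rule ext_iterate[OF ext_validD[OF P4(1)] _ P4(2)])
    show "(\<lambda>i. halves i [^]\<^bsub>K i\<^esub> (0::nat)) \<in> vals P4"
      using vals_mono[OF P4(1) vals_mono[OF P3(1) one2]] by (simp add: nat_pow_def)
  qed (simp add: nat_pow_def)
  then obtain P5 where P5: "ext (Suc k) P4 P5" "\<forall>j\<le>Suc k. (\<lambda>i. halves i [^]\<^bsub>K i\<^esub> j) \<in> vals P5" by blast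
  have late: "v \<in> vals P5" if "v \<in> vals P2" for v
    using vals_mono[OF P5(1) vals_mono[OF P4(1) vals_mono[OF P3(1) that]]] .
  have "ready P5"
    unfolding ready_def using ext_validD[OF P5(1)] P5(2) late[OF P2(2)] late[OF vals_mono[OF P2(1) pow1]] by simp
  moreover have "ext (2 * 2 ^ k + k + 4) P P5"
    by (rule ext_le[OF ext_trans[OF ext_trans[OF ext_trans[OF ext_trans[OF P1(1) P2(1)] P3(1)] P4(1)] P5(1)]]) simp
  ultimately show ?thesis by blast
qed

text \<open>The coefficients of \<open>q u\<close> below index \<open>d\<close> depend on
  \<open>u 0, \<dots>, u (d - 1)\<close> only, and the others vanish by
  \<open>conv_rec_denom\<close>. So the numerator is the truncation of \<open>r = q u'\<close>,
  where \<open>u'\<close> is the sequence cut off at \<open>d\<close>. One multiplication by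
  transforms yields \<open>r\<close>, and a fourth transform takes the truncation back to
  values.\<close>

lemma ext_init:
  assumes P: "ready P" and d: "1 \<le> d" "d < 2 ^ k"
    and c: "\<And>j. j < d \<Longrightarrow> (\<lambda>i. c i j) \<in> vals P" and u: "\<And>j. j < d \<Longrightarrow> (\<lambda>i. u i j) \<in> vals P"
    and rec: "\<And>i. i \<in> I \<Longrightarrow> lin_rec_seq (K i) d (c i) (u i)"
  shows "\<exists>P' p q. ext (4 * fft_ops (Suc k) + 5 * 2 ^ k) P P' \<and> represents d P' p q u"
proof -
  define q where "q i = rec_denom (K i) d (c i)" for i
  define u' where "u' i m = (if m < d then u i m else \<zero>\<^bsub>K i\<^esub>)" for i m
  define r where "r i = conv (K i) (q i) (u' i)" for i
  define p where "p i m = (if m < d then r i m else \<zero>\<^bsub>K i\<^esub>)" for i m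
  define Q where "Q y i = evalp (K i) (q i) (2 * 2 ^ k) (\<omega> i [^]\<^bsub>K i\<^esub> y)" for y :: nat and i
  define U where "U y i = evalp (K i) (u' i) (2 * 2 ^ k) (\<omega> i [^]\<^bsub>K i\<^esub> y)" for y :: nat and i
  have inst: "q i \<in> UNIV \<rightarrow> carrier (K i)" "u i \<in> UNIV \<rightarrow> carrier (K i)" "u' i \<in> UNIV \<rightarrow> carrier (K i)"
    "r i \<in> UNIV \<rightarrow> carrier (K i)" "p i \<in> UNIV \<rightarrow> carrier (K i)"
    "j < d \<Longrightarrow> q i (Suc j) = \<zero>\<^bsub>K i\<^esub> \<ominus>\<^bsub>K i\<^esub> c i (d - Suc j)"
    "conv (K i) (q i) (u i) = p i"
    "evalp (K i) (r i) (2 * 2 ^ k) (\<omega> i [^]\<^bsub>K i\<^esub> y) = Q y i \<otimes>\<^bsub>K i\<^esub> U y i"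
    if i: "i \<in> I" for i j y
  proof -
    interpret fft_field "K i" "\<omega> i" k using fft_field[OF i] .
    note L = rec[OF i]
    have ci: "c i \<in> {..<d} \<rightarrow> carrier (K i)" using L by (simp add: lin_rec_seq_def)
    show qi: "q i \<in> UNIV \<rightarrow> carrier (K i)" unfolding q_def by (rule rec_denom_closed[OF ci])
    show ui: "u i \<in> UNIV \<rightarrow> carrier (K i)" using lin_rec_seq_closed[OF d(1) L] .
    show u'i: "u' i \<in> UNIV \<rightarrow> carrier (K i)" using ui by (auto simp: u'_def)
    show ri: "r i \<in> UNIV \<rightarrow> carrier (K i)" unfolding r_def by (rule conv_closed[OF qi u'i])
    show pi: "p i \<in> UNIV \<rightarrow> carrier (K i)" using ri by (auto simp: p_def)
    show "q i (Suc j) = \<zero>\<^bsub>K i\<^esub> \<ominus>\<^bsub>K i\<^esub> c i (d - Suc j)" if "j < d"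
      using that ci by (auto simp: q_def rec_denom_def minus_eq Pi_def)
    show "conv (K i) (q i) (u i) = p i"
    proof
      fix m
      show "conv (K i) (q i) (u i) m = p i m"
      proof (cases "m < d")
        case True
        then show ?thesis
          using qi ui by (auto simp: p_def r_def conv_def u'_def Pi_def intro!: finsum_cong')
      next
        case False
        then obtain n where m: "m = n + d" by (metis add.commute le_add_diff_inverse not_less)
        show ?thesis using conv_rec_denom[OF d(1) L, of n] by (simp add: p_def q_def m)
      qed
    qed
    show "evalp (K i) (r i) (2 * 2 ^ k) (\<omega> i [^]\<^bsub>K i\<^esub> y) = Q y i \<otimes>\<^bsub>K i\<^esub> U y i"
      unfolding r_def Q_def U_def
      by (rule evalp_conv[OF qi u'i, where a = d and b = d])
        (use d root_closed in \<open>auto simp: q_def rec_denom_def u'_def\<close>)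
  qed
  have zero: "(\<lambda>i. \<zero>\<^bsub>K i\<^esub>) \<in> vals P" using P by (simp add: ready_def)
  have "opval P (\<lambda>i. q i (Suc j))" if "j < d" for j
    by (rule opval_sub[OF zero c[of "d - Suc j"]]) (use that inst(6) in auto)
  then obtain P1 where P1: "ext d P P1" "\<And>j. j < d \<Longrightarrow> (\<lambda>i. q i (Suc j)) \<in> vals P1"
    using ext_opvals[of P d "\<lambda>j i. q i (Suc j)"] P by (auto simp: ready_def)
  note ready1 = ready_mono[OF P P1(1)]
  have zero1: "(\<lambda>i. \<zero>\<^bsub>K i\<^esub>) \<in> vals P1" using ready1 by (simp add: ready_def)
  have q_vals: "(\<lambda>i. q i j) \<in> vals P1" for j
  proof -
    consider "j = 0" | "0 < j" "j \<le> d" | "d < j" by linarith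
    then show ?thesis
    proof cases
      case 1
      then show ?thesis using ready_root[OF ready1, of 0] by (simp add: q_def rec_denom_def nat_pow_def)
    next
      case 2
      then show ?thesis using P1(2)[of "j - 1"] by simp
    next
      case 3
      then show ?thesis using zero1 by (simp add: q_def rec_denom_def)
    qed
  qed
  obtain P2 where P2: "ext (fft_ops (Suc k)) P1 P2" "\<And>y. Q y \<in> vals P2"
    using ext_full_fft[OF ready1 inst(1) q_vals] by (auto simp: Q_def[abs_def])
  note ready2 = ready_mono[OF ready1 P2(1)]
  have u'_vals: "(\<lambda>i. u' i j) \<in> vals P2" for j
    using vals_mono[OF P2(1) vals_mono[OF P1(1) u[of j]]] vals_mono[OF P2(1) zero1] by (cases "j < d") (simp_all add: u'_def)
  obtain P3 where P3: "ext (fft_ops (Suc k)) P2 P3" "\<And>y. U y \<in> vals P3"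
    using ext_full_fft[OF ready2 inst(3) u'_vals] by (auto simp: U_def[abs_def])
  note ready3 = ready_mono[OF ready2 P3(1)]
  have "opval P3 (\<lambda>i. evalp (K i) (r i) (2 * 2 ^ k) (\<omega> i [^]\<^bsub>K i\<^esub> y))" for y :: nat
    by (rule opval_mult[OF vals_mono[OF P3(1) P2(2)] P3(2) inst(8)])
  then obtain P4 where P4: "ext (2 * 2 ^ k) P3 P4"
    "\<And>y::nat. y < 2 * 2 ^ k \<Longrightarrow> (\<lambda>i. evalp (K i) (r i) (2 * 2 ^ k) (\<omega> i [^]\<^bsub>K i\<^esub> y)) \<in> vals P4"
    using ext_opvals[of P3 "2 * 2 ^ k" "\<lambda>y i. evalp (K i) (r i) (2 * 2 ^ k) (\<omega> i [^]\<^bsub>K i\<^esub> y)"] ext_validD[OF P3(1)]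
    by auto
  note ready4 = ready_mono[OF ready3 P4(1)]
  have r_dft: "(\<lambda>i. evalp (K i) (r i) (2 * 2 ^ k) (\<omega> i [^]\<^bsub>K i\<^esub> y)) \<in> vals P4" for y :: nat
    by (rule vals_periodic[of "\<lambda>i. evalp (K i) (r i) (2 * 2 ^ k)"]) (rule P4(2))
  obtain P5 where P5: "ext (fft_ops (Suc k) + 2 * 2 ^ k) P4 P5" "\<And>j. j < 2 * 2 ^ k \<Longrightarrow> (\<lambda>i. r i j) \<in> vals P5"
    using ext_full_inverse_fft[OF ready4 inst(4) r_dft] by blast
  note ready5 = ready_mono[OF ready4 P5(1)]
  have p_vals: "(\<lambda>i. p i j) \<in> vals P5" for j
    using P5(2)[of j] d ready5 by (cases "j < d") (auto simp: p_def ready_def)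
  obtain P6 where P6: "ext (fft_ops (Suc k)) P5 P6"
    "\<And>y::nat. (\<lambda>i. evalp (K i) (p i) (2 * 2 ^ k) (\<omega> i [^]\<^bsub>K i\<^esub> y)) \<in> vals P6"
    using ext_full_fft[OF ready5 inst(5) p_vals] by blast
  have "(\<lambda>i. evalp (K i) (q i) (2 * 2 ^ k) (\<omega> i [^]\<^bsub>K i\<^esub> y)) \<in> vals P6" for y :: nat
    using vals_mono[OF P6(1) vals_mono[OF P5(1) vals_mono[OF P4(1) vals_mono[OF P3(1) P2(2)[of y]]]]]
    by (simp add: Q_def[abs_def])
  then have "represents d P6 p q u"
    unfolding represents_def using inst(1,2,5,7) P6(2) by (auto simp: p_def q_def rec_denom_def)
  moreover have "ext (4 * fft_ops (Suc k) + 5 * 2 ^ k) P P6"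
    by (rule ext_le[OF ext_trans[OF ext_trans[OF ext_trans[OF ext_trans[OF ext_trans[OF
      P1(1) P2(1)] P3(1)] P4(1)] P5(1)] P6(1)]]) (use d in simp)
  ultimately show ?thesis by blast
qed

end

section \<open>Programs for the terms of a recurrence\<close>

lemma fft_exponent_bound: "2 * d + 1 \<le> 2 ^ fft_exponent d"
  unfolding fft_exponent_def
  by (rule LeastI_ex) (use less_exp[of "2 * d + 1"] less_imp_le in blast)

lemma fft_exponent_pos: "1 \<le> d \<Longrightarrow> 0 < fft_exponent d"
  using fft_exponent_bound[of d] by (cases "fft_exponent d") auto

text \<open>The power \<open>x\<close> of the root at half its order satisfies
  \<open>x^2 = 1\<close> and \<open>x \<noteq> 1\<close>, so \<open>x = -1\<close> in a field. In
  particular \<open>-1 \<noteq> 1\<close>, that is, two is nonzero.\<close>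

lemma supports_FFT_imp_fft_field:
  assumes "supports_FFT K d \<omega>" and k: "fft_exponent d = Suc k"
  shows "fft_field K \<omega> k"
proof -
  interpret field K using assms by (simp add: supports_FFT_def)
  interpret M: group "mult_of K" by (rule field_mult_group)
  have w: "\<omega> \<in> carrier (mult_of K)" "group.ord (mult_of K) \<omega> = 2 * 2 ^ k"
    using assms by (auto simp: supports_FFT_def primitive_root_of_unity_def)
  then have wc: "\<omega> \<in> carrier K" by simp
  have one: "\<omega> [^]\<^bsub>K\<^esub> (j::nat) = \<one>\<^bsub>K\<^esub> \<longleftrightarrow> 2 * 2 ^ k dvd j" for j
    using M.pow_eq_id[OF w(1), of j] w(2) by (simp add: nat_pow_mult_of)
  define x where "x = \<omega> [^]\<^bsub>K\<^esub> ((2::nat) ^ k)"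
  have x: "x \<in> carrier K" using wc by (simp add: x_def)
  have x1: "x \<noteq> \<one>\<^bsub>K\<^esub>" unfolding x_def one using nat_dvd_not_less by fastforce
  have xx: "x \<otimes>\<^bsub>K\<^esub> x = \<one>\<^bsub>K\<^esub>" using one[of "2 * 2 ^ k"] wc by (simp add: x_def nat_pow_mult mult_2)
  have "(x \<ominus>\<^bsub>K\<^esub> \<one>\<^bsub>K\<^esub>) \<otimes>\<^bsub>K\<^esub> (x \<oplus>\<^bsub>K\<^esub> \<one>\<^bsub>K\<^esub>) = x \<otimes>\<^bsub>K\<^esub> x \<ominus>\<^bsub>K\<^esub> \<one>\<^bsub>K\<^esub>"
    using x by algebra
  then have "(x \<ominus>\<^bsub>K\<^esub> \<one>\<^bsub>K\<^esub>) \<otimes>\<^bsub>K\<^esub> (x \<oplus>\<^bsub>K\<^esub> \<one>\<^bsub>K\<^esub>) = \<zero>\<^bsub>K\<^esub>"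
    using xx by (simp add: minus_eq r_neg)
  moreover have "x \<ominus>\<^bsub>K\<^esub> \<one>\<^bsub>K\<^esub> \<noteq> \<zero>\<^bsub>K\<^esub>" using x x1 by simp
  ultimately have "x \<oplus>\<^bsub>K\<^esub> \<one>\<^bsub>K\<^esub> = \<zero>\<^bsub>K\<^esub>" using x by (subst (asm) integral_iff) auto
  then have xm: "x = \<ominus>\<^bsub>K\<^esub> \<one>\<^bsub>K\<^esub>" using x by (metis minus_equality minus_minus one_closed)
  show ?thesis
  proof unfold_locales
    show "\<omega> \<in> carrier K" by (rule wc)
    show "\<omega> [^]\<^bsub>K\<^esub> ((2::nat) ^ k) = \<ominus>\<^bsub>K\<^esub> \<one>\<^bsub>K\<^esub>" using xm by (simp add: x_def)
    show "\<omega> [^]\<^bsub>K\<^esub> j \<noteq> \<one>\<^bsub>K\<^esub>" if "0 < j" "j < 2 * 2 ^ k" for j :: nat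
      unfolding one using that nat_dvd_not_less by blast
    show "\<one>\<^bsub>K\<^esub> \<oplus>\<^bsub>K\<^esub> \<one>\<^bsub>K\<^esub> \<noteq> \<zero>\<^bsub>K\<^esub>"
      using x1 xm by (metis minus_equality one_closed)
  qed
qed

definition nth_term_ops :: "nat \<Rightarrow> nat \<Rightarrow> nat" where
  "nth_term_ops k t = (2 * 2 ^ k + k + 4) + (4 * fft_ops (Suc k) + 5 * 2 ^ k) +
     (t * (4 * fft_ops k + 10 * 2 ^ k) + (fft_ops (Suc k) + 2 * 2 ^ k))"

lemma nth_term_slp:
  assumes d: "1 \<le> d" and k: "fft_exponent d = Suc k" and N: "N < 2 ^ t"
  shows "\<exists>prog. slp_cost prog = nth_term_ops k t \<and>
    (\<forall>(K :: ('a, 'b) ring_scheme) \<omega> c u. supports_FFT K d \<omega> \<longrightarrow> lin_rec_seq K d c u \<longrightarrow>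
       slp_result K prog (nth_term_inputs K \<omega> d c u) = Some (u N))"
proof -
  \<comment> \<open>The field is itself a component of an instance. This is what makes one program
    valid over all fields, roots and recurrences.\<close>
  define I :: "(('a, 'b) ring_scheme \<times> 'a \<times> (nat \<Rightarrow> 'a) \<times> (nat \<Rightarrow> 'a)) set"
    where "I = {(K, \<omega>, c, u). supports_FFT K d \<omega> \<and> lin_rec_seq K d c u}"
  define inp :: "('a, 'b) ring_scheme \<times> 'a \<times> (nat \<Rightarrow> 'a) \<times> (nat \<Rightarrow> 'a) \<Rightarrow> 'a list"
    where "inp = (\<lambda>(K, \<omega>, c, u). nth_term_inputs K \<omega> d c u)"
  define w :: "('a, 'b) ring_scheme \<times> 'a \<times> (nat \<Rightarrow> 'a) \<times> (nat \<Rightarrow> 'a) \<Rightarrow> 'a" where "w = (\<lambda>(K, \<omega>, c, u). \<omega>)"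
  define c :: "('a, 'b) ring_scheme \<times> 'a \<times> (nat \<Rightarrow> 'a) \<times> (nat \<Rightarrow> 'a) \<Rightarrow> nat \<Rightarrow> 'a" where "c = (\<lambda>(K, \<omega>, c, u). c)"
  define u :: "('a, 'b) ring_scheme \<times> 'a \<times> (nat \<Rightarrow> 'a) \<times> (nat \<Rightarrow> 'a) \<Rightarrow> nat \<Rightarrow> 'a" where "u = (\<lambda>(K, \<omega>, c, u). u)"
  have dk: "d < 2 ^ k" using fft_exponent_bound[of d] k by simp
  interpret fft_family I fst inp "2 + 2 * d" w k
  proof (intro fft_family.intro slp_family.intro fft_family_axioms.intro)
    fix i assume i: "i \<in> I"
    show "length (inp i) = 2 + 2 * d" by (cases i) (simp add: inp_def nth_term_inputs_def)
    show "field (fst i)" using i by (auto simp: I_def supports_FFT_def)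
    show "fft_field (fst i) (w i) k"
      using i supports_FFT_imp_fft_field[OF _ k] by (auto simp: I_def w_def)
  qed
  have valid0: "valid []" by (simp add: valid_def)
  have inputs: "v \<in> vals []" if "a < 2 + 2 * d" "\<And>i. i \<in> I \<Longrightarrow> inp i ! a = v i" for a v
    using that length_inp by (auto simp: vals_def mem_def intro!: exI[of _ a])
  have one0: "(\<lambda>i. \<one>\<^bsub>fst i\<^esub>) \<in> vals []"
    by (rule inputs[of 0]) (auto simp: inp_def nth_term_inputs_def)
  have w0: "w \<in> vals []"
    by (rule inputs[of 1]) (auto simp: inp_def w_def nth_term_inputs_def)
  have c0: "(\<lambda>i. c i j) \<in> vals []" if "j < d" for j
    by (rule inputs[of "2 + j"]) (use that in \<open>auto simp: inp_def c_def nth_term_inputs_def nth_append\<close>)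
  have u0: "(\<lambda>i. u i j) \<in> vals []" if "j < d" for j
    by (rule inputs[of "2 + d + j"]) (use that in \<open>auto simp: inp_def u_def nth_term_inputs_def nth_append\<close>)
  have rec: "lin_rec_seq (fst i) d (c i) (u i)" if "i \<in> I" for i
    using that by (auto simp: I_def c_def u_def)
  obtain P1 where P1: "ext (2 * 2 ^ k + k + 4) [] P1" "ready P1"
    using ext_ready[OF valid0 one0 w0] by blast
  obtain P2 p q where P2: "ext (4 * fft_ops (Suc k) + 5 * 2 ^ k) P1 P2" "represents d P2 p q u"
    using ext_init[OF P1(2) d dk vals_mono[OF P1(1) c0] vals_mono[OF P1(1) u0] rec] by blast
  obtain P3 where P3: "ext (t * (4 * fft_ops k + 10 * 2 ^ k) + (fft_ops (Suc k) + 2 * 2 ^ k)) P2 P3"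
    "(\<lambda>i. u i N) \<in> vals P3"
    using ext_loop[OF ready_mono[OF P1(2) P2(1)] P2(2) d dk N] by blast
  have "ext (nth_term_ops k t) [] P3"
    unfolding nth_term_ops_def by (rule ext_trans[OF ext_trans[OF P1(1) P2(1)] P3(1)])
  from ext_pad[OF this one0 P3(2)] obtain P
    where P: "length P = nth_term_ops k t" "valid P" "(\<lambda>i. u i N) \<in> vals P" by auto
  then obtain a where a: "\<And>i. i \<in> I \<Longrightarrow> a < length (mem P i) \<and> mem P i ! a = u i N"
    by (auto simp: vals_def)
  have "slp_result K (P, a) (nth_term_inputs K \<omega> d c' u') = Some (u' N)"
    if "supports_FFT K d \<omega>" "lin_rec_seq K d c' u'" for K :: "('a, 'b) ring_scheme" and \<omega> c' u'
  proof -
    have i: "(K, \<omega>, c', u') \<in> I" using that by (simp add: I_def)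
    then have "exec (fst (K, \<omega>, c', u')) P (inp (K, \<omega>, c', u')) \<noteq> None"
      using P(2) unfolding valid_def by blast
    then obtain m where m: "exec (fst (K, \<omega>, c', u')) P (inp (K, \<omega>, c', u')) = Some m"
      by auto
    then have "mem P (K, \<omega>, c', u') = m" unfolding mem_def by simp
    then have "a < length m" "m ! a = u' N" using a[OF i] by (auto simp: u_def)
    then show ?thesis using m by (simp add: slp_result_def inp_def)
  qed
  then show ?thesis using P(1) by (intro exI[of _ "(P, a)"]) (simp add: slp_cost_def)
qed

lemma fft_ops_eq: "2 * fft_ops m = 3 * m * 2 ^ m"
  by (induction m) (simp_all add: algebra_simps)

text \<open>Writing \<open>6 * k + 10\<close> as \<open>6 * Suc k + 4\<close> exposes the main term.
  For \<open>n = 2 ^ Suc k\<close> it is \<open>3 * n * log n\<close> per step, against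
  \<open>9 / 2 * n * log n\<close> for a multiplication, and the quotient is
  \<open>2 / 3\<close>.\<close>

lemma nth_term_ops_eq:
  "real (nth_term_ops k t) = real t * (6 * real (Suc k) + 4) * 2 ^ k + 15 * real (Suc k) * 2 ^ k + 9 * 2 ^ k + real k + 4"
proof -
  have k: "4 * fft_ops k = 6 * k * 2 ^ k" using fft_ops_eq[of k] by simp
  have "2 * (5 * fft_ops (Suc k)) = 2 * (15 * Suc k * 2 ^ k)"
    using fft_ops_eq[of "Suc k"] by (simp add: algebra_simps)
  then have Sk: "5 * fft_ops (Suc k) = 15 * Suc k * 2 ^ k" by linarith
  have "nth_term_ops k t = t * (4 * fft_ops k + 10 * 2 ^ k) + 5 * fft_ops (Suc k) + 9 * 2 ^ k + k + 4"
    unfolding nth_term_ops_def by simp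
  also have "\<dots> = t * (6 * k * 2 ^ k + 10 * 2 ^ k) + 15 * Suc k * 2 ^ k + 9 * 2 ^ k + k + 4"
    unfolding k Sk ..
  finally show ?thesis by (simp add: algebra_simps)
qed

section \<open>Asymptotic cost\<close>

lemma filterlim_fft_exponent: "filterlim fft_exponent at_top at_top"
  unfolding filterlim_at_top
proof
  fix C
  have "C \<le> fft_exponent d" if "2 ^ C \<le> d" for d
  proof (rule ccontr)
    assume "\<not> C \<le> fft_exponent d"
    then have "(2::nat) ^ fft_exponent d \<le> 2 ^ C" by (intro power_increasing) auto
    then show False using that fft_exponent_bound[of d] by linarith
  qed
  then show "\<forall>\<^sub>F d in at_top. C \<le> fft_exponent d"
    unfolding eventually_at_top_linorder by blast
qed

lemma filterlim_fst: "filterlim fst F (F \<times>\<^sub>F G)"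
  by (simp add: filterlim_def filtermap_fst_prod_filter)

lemma filterlim_snd: "filterlim snd G (F \<times>\<^sub>F G)"
  by (simp add: filterlim_def filtermap_snd_prod_filter)

text \<open>For \<open>n = 2 ^ fft_exponent d\<close> three transforms cost
  \<open>9 / 2 * n * log n\<close>. As \<open>d \<le> n\<close>, the linear remainder is at most the
  fraction \<open>2 / 9 * c / log n\<close> of this.\<close>

lemma FFT_mult_cost_asymp:
  assumes "FFT_mult_cost M"
  shows "((\<lambda>d. M d / (9 / 2 * 2 ^ fft_exponent d * real (fft_exponent d))) \<longlongrightarrow> 1) at_top"
proof -
  from assms obtain c where c: "c > 0"
    "\<forall>\<^sub>F d in at_top. \<bar>M d - 3 * FFT_cost (2 ^ fft_exponent d)\<bar> \<le> c * real d"
    unfolding FFT_mult_cost_def by (elim landau_o.bigE) (auto simp: norm_conv_dist)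
  have m: "filterlim (\<lambda>d. real (fft_exponent d)) at_top at_top"
    by (rule filterlim_compose[OF filterlim_real_sequentially filterlim_fft_exponent])
  have lim: "((\<lambda>d. c * inverse (real (fft_exponent d))) \<longlongrightarrow> 0) at_top"
    using tendsto_mult[OF tendsto_const[of c] filterlim_compose[OF tendsto_inverse_0_at_top[OF filterlim_ident] m]]
    by simp
  have "((\<lambda>d. M d / (9 / 2 * 2 ^ fft_exponent d * real (fft_exponent d)) - 1) \<longlongrightarrow> 0) at_top"
  proof (rule tendsto_0_le[OF lim])
    show "\<forall>\<^sub>F d in at_top. norm (M d / (9 / 2 * 2 ^ fft_exponent d * real (fft_exponent d)) - 1)
        \<le> norm (c * inverse (real (fft_exponent d))) * 1"
      using c(2) eventually_ge_at_top[of 1]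
    proof eventually_elim
      case (elim d)
      define m where "m = real (fft_exponent d)"
      define n where "n = (2::real) ^ fft_exponent d"
      have m: "m > 0" using fft_exponent_pos[OF elim(2)] by (simp add: m_def)
      have "real (2 * d + 1) \<le> n" unfolding n_def using fft_exponent_bound[of d]
        by (metis of_nat_le_iff of_nat_power of_nat_numeral)
      then have n: "n > 0" "real d \<le> n" by auto
      have e: "\<bar>M d - 9 / 2 * n * m\<bar> \<le> c * real d"
        using elim(1) by (simp add: FFT_cost_def m_def n_def log_nat_power field_simps)
      have "norm (M d / (9 / 2 * n * m) - 1) = \<bar>M d - 9 / 2 * n * m\<bar> / (9 / 2 * n * m)"
      proof -
        have "M d / (9 / 2 * n * m) - 1 = (M d - 9 / 2 * n * m) / (9 / 2 * n * m)"
          using m n by (simp add: field_simps)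
        then show ?thesis using m n by (simp only: real_norm_def abs_divide) simp
      qed
      also have "\<dots> \<le> (c * n) / (9 / 2 * n * m)"
        using e n m c(1) by (intro divide_right_mono) (auto intro: order_trans mult_left_mono)
      also have "\<dots> = 2 / 9 * (c * inverse m)" using n m by (simp add: field_simps)
      also have "\<dots> \<le> norm (c * inverse m) * 1" using c m by simp
      finally show ?case by (simp add: m_def n_def)
    qed
  qed
  from tendsto_add[OF this tendsto_const[of 1]] show ?thesis by simp
qed

text \<open>The quotient is at least 1 since \<open>t N\<close> is at least \<open>log N\<close>,
  and at most a polynomial in \<open>a = 1 / log N\<close> and
  \<open>b = 1 / fft_exponent d\<close>. Both tend to 0 along the product filter, whatever the
  relative growth of \<open>d\<close> and \<open>N\<close>.\<close>

lemma nth_term_ops_asymp: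
  fixes t :: "nat \<Rightarrow> nat"
  assumes t: "\<And>N. 1 \<le> N \<Longrightarrow> log 2 (real N) \<le> real (t N)" "\<And>N. 1 \<le> N \<Longrightarrow> real (t N) \<le> log 2 (real N) + 1"
  shows "((\<lambda>(d, N). real (nth_term_ops (fft_exponent d - 1) (t N)) /
     (3 * 2 ^ fft_exponent d * real (fft_exponent d) * log 2 (real N))) \<longlongrightarrow> 1) (at_top \<times>\<^sub>F at_top)"
proof -
  define a :: "nat \<times> nat \<Rightarrow> real" where "a x = inverse (log 2 (real (snd x)))" for x
  define b :: "nat \<times> nat \<Rightarrow> real" where "b x = inverse (real (fft_exponent (fst x)))" for x
  have "filterlim (\<lambda>N. log 2 (real N)) at_top at_top"
    unfolding log_def divide_inverse mult.commute[of _ "inverse (ln 2)"]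
    by (intro filterlim_tendsto_pos_mult_at_top[OF tendsto_const] filterlim_compose[OF ln_at_top]
        filterlim_real_sequentially) simp
  then have a: "(a \<longlongrightarrow> 0) (at_top \<times>\<^sub>F at_top)"
    unfolding a_def[abs_def]
    by (intro tendsto_inverse_0_at_top filterlim_compose[OF _ filterlim_snd])
  have b: "(b \<longlongrightarrow> 0) (at_top \<times>\<^sub>F at_top)"
    unfolding b_def[abs_def]
    by (intro tendsto_inverse_0_at_top filterlim_compose[OF filterlim_real_sequentially]
        filterlim_compose[OF filterlim_fft_exponent filterlim_fst])
  \<comment> \<open>With \<open>m = Suc k\<close> and \<open>h = 2 ^ k\<close> the main term is
    \<open>6 * h * m * log N\<close>. Rounding \<open>log N\<close> up gives \<open>1 + a\<close>,
    the linear part of a step \<open>4 / (6 * m)\<close>, and the other phases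
    \<open>15 * m * h\<close> and \<open>9 * h\<close>. The remaining \<open>k + 4 = m + 3\<close>
    is at most \<open>4 * h\<close>, whence \<open>13 / 6\<close>.\<close>
  have upper: "((\<lambda>x. (1 + a x) * (1 + 2 / 3 * b x) + 5 / 2 * a x + 13 / 6 * a x * b x) \<longlongrightarrow> 1) (at_top \<times>\<^sub>F at_top)"
    by (rule tendsto_eq_intros a b refl)+ simp
  have ev: "\<forall>\<^sub>F x in at_top \<times>\<^sub>F at_top. 1 \<le> fst x \<and> 2 \<le> snd (x :: nat \<times> nat)"
    by (intro eventually_conj eventually_compose_filterlim[OF _ filterlim_fst] eventually_compose_filterlim[OF _ filterlim_snd]
        eventually_ge_at_top)
  have bounds: "1 \<le> r \<and> r \<le> (1 + a x) * (1 + 2 / 3 * b x) + 5 / 2 * a x + 13 / 6 * a x * b x"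
    if x: "1 \<le> fst x" "2 \<le> snd x" and r: "r = (case x of (d, N) \<Rightarrow> real (nth_term_ops (fft_exponent d - 1) (t N)) /
     (3 * 2 ^ fft_exponent d * real (fft_exponent d) * log 2 (real N)))" for x r
  proof -
    obtain d N where [simp]: "x = (d, N)" by (cases x)
    obtain k where k: "fft_exponent d = Suc k" using fft_exponent_pos[of d] x by (cases "fft_exponent d") auto
    define h where "h = (2::real) ^ k"
    define m where "m = real (Suc k)"
    define X where "X = log 2 (real N)"
    define T where "T = real (t N)"
    have h: "h > 0" by (simp add: h_def)
    have m: "m \<ge> 1" by (simp add: m_def)
    have X: "X \<ge> 1" using x by (simp add: X_def)
    have T: "X \<le> T" "T \<le> X + 1" using t x by (auto simp: X_def T_def)
    have mh: "m \<le> h" unfolding m_def h_def using less_exp[of k]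
      by (metis Suc_leI of_nat_le_iff of_nat_numeral of_nat_power)
    have ab: "a x = inverse X" "b x = inverse m" by (simp_all add: a_def b_def X_def m_def k)
    have "r = (T * (6 * m + 4) * h + 15 * m * h + 9 * h + m + 3) / (6 * h * m * X)"
      unfolding r by (simp add: nth_term_ops_eq k h_def m_def X_def T_def algebra_simps)
    moreover have "6 * h * m * X \<le> T * (6 * m + 4) * h + 15 * m * h + 9 * h + m + 3"
    proof -
      have "X * (6 * m) * h \<le> T * (6 * m + 4) * h"
        using T X m h by (intro mult_right_mono mult_mono) auto
      moreover have "6 * h * m * X = X * (6 * m) * h" by simp
      moreover have "0 \<le> 15 * m * h" using m h by simp
      ultimately show ?thesis using m h by linarith
    qed
    moreover have "T * (6 * m + 4) * h + 15 * m * h + 9 * h + m + 3 \<le>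
      ((1 + a x) * (1 + 2 / 3 * b x) + 5 / 2 * a x + 13 / 6 * a x * b x) * (6 * h * m * X)"
    proof -
      have "((1 + a x) * (1 + 2 / 3 * b x) + 5 / 2 * a x + 13 / 6 * a x * b x) * (6 * h * m * X) =
        (X + 1) * (6 * m + 4) * h + 15 * m * h + 13 * h"
        unfolding ab using X m by (simp add: field_simps)
      moreover have "T * (6 * m + 4) * h \<le> (X + 1) * (6 * m + 4) * h"
        using T X m h by (intro mult_right_mono) auto
      moreover have "m + 3 \<le> 4 * h" using mh m by linarith
      ultimately show ?thesis by linarith
    qed
    moreover have "0 < 6 * h * m * X" using h m X by simp
    ultimately show ?thesis by (simp add: le_divide_eq divide_le_eq)
  qed
  show ?thesis
    by (rule tendsto_sandwich[OF _ _ tendsto_const[of 1] upper]; rule eventually_mono[OF ev]) (use bounds in blast)+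
qed

theorem theorem2:
  fixes M :: "nat \<Rightarrow> real"
  assumes "FFT_mult_cost M"
  shows "\<exists>prog :: nat \<Rightarrow> nat \<Rightarrow> slp.
    (\<forall>(K :: ('a, 'b) ring_scheme) \<omega> d c u N.
       1 \<le> d \<longrightarrow> 1 \<le> N \<longrightarrow> supports_FFT K d \<omega> \<longrightarrow> lin_rec_seq K d c u \<longrightarrow>
       slp_result K (prog d N) (nth_term_inputs K \<omega> d c u) = Some (u N)) \<and>
    (\<lambda>(d, N). real (slp_cost (prog d N)))
      \<sim>[at_top \<times>\<^sub>F at_top] (\<lambda>(d, N). 2 / 3 * M d * log 2 (real N))"
proof -
  \<comment> \<open>The number of binary digits of \<open>N\<close>. Adding 1 to the floor keeps
    \<open>N < 2 ^ t N\<close> strict even for powers of two.\<close>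
  define t where "t N = Suc (nat \<lfloor>log 2 (real N)\<rfloor>)" for N :: nat
  have t: "log 2 (real N) \<le> real (t N)" "real (t N) \<le> log 2 (real N) + 1" "N < 2 ^ t N" if "1 \<le> N" for N
  proof -
    have pos: "0 \<le> log 2 (real N)" using that by simp
    then show *: "real (t N) \<le> log 2 (real N) + 1" by (simp add: t_def)
    have less: "log 2 (real N) < real (t N)" using pos unfolding t_def by simp linarith
    then show "log 2 (real N) \<le> real (t N)" by simp
    have "real N < 2 powr real (t N)" using less that by (simp add: log_less_iff)
    then have "real N < real (2 ^ t N)" by (simp add: powr_realpow)
    then show "N < 2 ^ t N" by (simp only: of_nat_less_iff)
  qed
  have "\<exists>prog. slp_cost prog = nth_term_ops (fft_exponent d - 1) (t N) \<and>
    (1 \<le> d \<longrightarrow> 1 \<le> N \<longrightarrow> (\<forall>(K :: ('a, 'b) ring_scheme) \<omega> c u. supports_FFT K d \<omega> \<longrightarrow> lin_rec_seq K d c u \<longrightarrow>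
       slp_result K prog (nth_term_inputs K \<omega> d c u) = Some (u N)))" for d N
  proof (cases "1 \<le> d \<and> 1 \<le> N")
    case True
    then have "fft_exponent d = Suc (fft_exponent d - 1)" using fft_exponent_pos[of d] by simp
    from nth_term_slp[OF conjunct1[OF True] this t(3)[OF conjunct2[OF True]]] show ?thesis
      by (elim exE conjE) (intro exI conjI impI, assumption+)
  next
    \<comment> \<open>Outside the range of the claim an idle program of the same length is chosen,
      so that the formula for the cost holds for all \<open>d\<close> and \<open>N\<close>.\<close>
    case False
    then show ?thesis
      by (intro exI[of _ "(replicate (nth_term_ops (fft_exponent d - 1) (t N)) (Add, 0, 0), 0)"])
        (auto simp: slp_cost_def)
  qed
  then obtain prog where prog: "\<And>d N. slp_cost (prog d N) = nth_term_ops (fft_exponent d - 1) (t N)"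
    "\<And>d N (K :: ('a, 'b) ring_scheme) \<omega> c u. 1 \<le> d \<Longrightarrow> 1 \<le> N \<Longrightarrow> supports_FFT K d \<omega> \<Longrightarrow> lin_rec_seq K d c u \<Longrightarrow>
       slp_result K (prog d N) (nth_term_inputs K \<omega> d c u) = Some (u N)"
    by metis
  \<comment> \<open>Both sides are compared with the common main term, since \<open>M\<close> is
    known only up to a linear error.\<close>
  let ?g = "\<lambda>(d, N). 3 * 2 ^ fft_exponent d * real (fft_exponent d) * log 2 (real N)"
  have "(\<lambda>(d, N). real (slp_cost (prog d N))) \<sim>[at_top \<times>\<^sub>F at_top] ?g"
    using nth_term_ops_asymp[of t] t by (intro asymp_equivI') (simp add: prog(1) case_prod_unfold)
  moreover have "(\<lambda>(d, N). 2 / 3 * M d * log 2 (real N)) \<sim>[at_top \<times>\<^sub>F at_top] ?g"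
  proof (rule asymp_equivI')
    have "((\<lambda>x. M (fst x) / (9 / 2 * 2 ^ fft_exponent (fst x) * real (fft_exponent (fst x)))) \<longlongrightarrow> 1) (at_top \<times>\<^sub>F (at_top :: nat filter))"
      by (rule filterlim_compose[OF FFT_mult_cost_asymp[OF assms] filterlim_fst])
    moreover have "\<forall>\<^sub>F x in at_top \<times>\<^sub>F at_top. 2 \<le> snd (x :: nat \<times> nat)"
      by (intro eventually_compose_filterlim[OF _ filterlim_snd] eventually_ge_at_top)
    then have "\<forall>\<^sub>F x in at_top \<times>\<^sub>F at_top.
      M (fst x) / (9 / 2 * 2 ^ fft_exponent (fst x) * real (fft_exponent (fst x))) =
      (case x of (d, N) \<Rightarrow> 2 / 3 * M d * log 2 (real N)) / ?g x"
    proof eventually_elim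
      case (elim x)
      then have "log 2 (real (snd x)) > 0" by simp
      \<comment> \<open>If \<open>fft_exponent\<close> is 0, both quotients are 0 by the convention
        for division by zero.\<close>
      then show ?case by (cases "fft_exponent (fst x) = 0") (auto simp: case_prod_unfold field_simps)
    qed
    ultimately show "((\<lambda>x. (case x of (d, N) \<Rightarrow> 2 / 3 * M d * log 2 (real N)) / ?g x) \<longlongrightarrow> 1) (at_top \<times>\<^sub>F at_top)"
      by (rule Lim_transform_eventually)
  qed
  ultimately have "(\<lambda>(d, N). real (slp_cost (prog d N)))
      \<sim>[at_top \<times>\<^sub>F at_top] (\<lambda>(d, N). 2 / 3 * M d * log 2 (real N))"
    by - (rule asymp_equiv_trans[OF _ asymp_equiv_symI])
  with prog(2) show ?thesis by (intro exI[of _ prog] conjI allI impI)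
qed

end
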